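(* Given a positive integer $r$, there is an algorithm that enumerates all sets of $r$ linearly independent vectors in $GF(2)^r$, each exactly once, with delay $\mathcal O(r^3+r^2\tau_{\mathrm{DET}}(r))$.
   Context: $GF(2)$ is the two-element field; linear independence is over $GF(2)$. $\tau_{\mathrm{DET}}(r)$ denotes the time to compute the determinant over $GF(2)$ of a given $r\times r$ binary matrix. Delay means the maximum time between two consecutive outputs (and before the first / after the last). *)

theory Defs
  imports
    "HOL-Library.Z2"
    "HOL-Library.Landau_Symbols"
    "Jordan_Normal_Form.Determinant"
    "Jordan_Normal_Form.VS_Connect"
begin

text \<open>
  The machine model is a structured word RAM: a register file addressed by literals, a main memory
  addressed indirectly through registers, and unit cost for every instruction and every test. The
  parameter \<open>W\<close> bounds the words: an instruction whose result is not below \<open>W\<close> has no transition.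
  With \<open>W\<close> polynomial in the input dimension \<open>r\<close>, words have \<open>O(log r)\<close> bits, so the unit cost
  cannot be abused by packing long bit strings into single words; all memory addresses are below
  \<open>W\<close>, too.
\<close>

record state =
  reg :: "nat \<Rightarrow> nat"
  mem :: "nat \<Rightarrow> nat"

datatype arith = Addition | Subtraction | Multiplication | Division | Remainder

fun arith_val :: "arith \<Rightarrow> nat \<Rightarrow> nat \<Rightarrow> nat" where
  "arith_val Addition a b = a + b"
| "arith_val Subtraction a b = a - b"
| "arith_val Multiplication a b = a * b"
| "arith_val Division a b = a div b"
| "arith_val Remainder a b = a mod b"

datatype test = Less nat nat | Equal nat nat

fun test_val :: "test \<Rightarrow> state \<Rightarrow> bool" where
  "test_val (Less x y) s \<longleftrightarrow> reg s x < reg s y"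
| "test_val (Equal x y) s \<longleftrightarrow> reg s x = reg s y"

datatype com =
    Skip
  | Const nat nat
  | Copy nat nat
  | Arith arith nat nat nat
  | Load nat nat
  | Store nat nat
  | Print nat
  | Emit
  | Seq com com
  | If test com com
  | While test com

text \<open>
  A run produces one event per unit of time, so the running time is the length of the trace.
  A solution is printed word by word, each word taking one time unit, and is completed by
  \<open>Emitted\<close>.
\<close>

datatype event = Tick | Printed nat | Emitted

inductive exec :: "nat \<Rightarrow> com \<Rightarrow> state \<Rightarrow> event list \<Rightarrow> state \<Rightarrow> bool" for W :: nat where
  Skip: "exec W Skip s [Tick] s"
| Const: "k < W \<Longrightarrow> exec W (Const x k) s [Tick] (s\<lparr>reg := (reg s)(x := k)\<rparr>)"
| Copy: "exec W (Copy x y) s [Tick] (s\<lparr>reg := (reg s)(x := reg s y)\<rparr>)"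
| Arith: "v = arith_val f (reg s y) (reg s z) \<Longrightarrow> v < W \<Longrightarrow>
    exec W (Arith f x y z) s [Tick] (s\<lparr>reg := (reg s)(x := v)\<rparr>)"
| Load: "exec W (Load x y) s [Tick] (s\<lparr>reg := (reg s)(x := mem s (reg s y))\<rparr>)"
| Store: "exec W (Store x y) s [Tick] (s\<lparr>mem := (mem s)(reg s x := reg s y)\<rparr>)"
| Print: "exec W (Print x) s [Printed (reg s x)] s"
| Emit: "exec W Emit s [Emitted] s"
| Seq: "exec W c1 s tr1 s1 \<Longrightarrow> exec W c2 s1 tr2 s2 \<Longrightarrow> exec W (Seq c1 c2) s (tr1 @ tr2) s2"
| IfTrue: "test_val b s \<Longrightarrow> exec W c1 s tr s1 \<Longrightarrow> exec W (If b c1 c2) s (Tick # tr) s1"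
| IfFalse: "\<not> test_val b s \<Longrightarrow> exec W c2 s tr s1 \<Longrightarrow> exec W (If b c1 c2) s (Tick # tr) s1"
| WhileFalse: "\<not> test_val b s \<Longrightarrow> exec W (While b c) s [Tick] s"
| WhileTrue: "test_val b s \<Longrightarrow> exec W c s tr1 s1 \<Longrightarrow> exec W (While b c) s1 tr2 s2 \<Longrightarrow>
    exec W (While b c) s (Tick # tr1 @ tr2) s2"

inductive_cases exec_elims:
  "exec W Skip s tr t"
  "exec W (Const x k) s tr t"
  "exec W (Copy x y) s tr t"
  "exec W (Arith f x y z) s tr t"
  "exec W (Load x y) s tr t"
  "exec W (Store x y) s tr t"
  "exec W (Print x) s tr t"
  "exec W Emit s tr t"
  "exec W (Seq c1 c2) s tr t"
  "exec W (If b c1 c2) s tr t"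

inductive_cases exec_WhileE: "exec W (While b c) s tr t"

text \<open>Runs are unique, so the existential quantifiers over runs below are harmless.\<close>

lemma exec_deterministic:
  "exec W c s tr t \<Longrightarrow> exec W c s tr' t' \<Longrightarrow> tr' = tr \<and> t' = t"
proof (induction arbitrary: tr' t' rule: exec.induct)
  case (WhileFalse b s c)
  from WhileFalse.prems show ?case
    by (rule exec_WhileE) (use WhileFalse.hyps in auto)
next
  case (WhileTrue b s c tr1 s1 tr2 s2)
  from WhileTrue.prems show ?case
    by (rule exec_WhileE) (use WhileTrue.hyps WhileTrue.IH in blast)+
qed (blast elim: exec_elims)+

text \<open>Input: register 0 holds the dimension, all other registers are zero.\<close>

definition init_state :: "nat \<Rightarrow> (nat \<Rightarrow> nat) \<Rightarrow> state" where
  "init_state r m = \<lparr>reg = (\<lambda>x. if x = 0 then r else 0), mem = m\<rparr>"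

definition mat_mem :: "nat \<Rightarrow> bit mat \<Rightarrow> nat \<Rightarrow> nat" where
  "mat_mem r A a = (if a < r * r then of_bool (A $$ (a div r, a mod r) = 1) else 0)"

definition word_bound :: "nat \<Rightarrow> nat \<Rightarrow> nat" where
  "word_bound K r = K * r ^ K"

text \<open>
  The program \<open>D\<close> computes, on words of \<open>O(log r)\<close> bits, the determinant over GF(2) of every
  \<open>r \<times> r\<close> matrix, given in row-major order, within \<open>\<tau> r\<close> steps; the result is left in register 0.
\<close>

definition computes_det_in_time :: "com \<Rightarrow> (nat \<Rightarrow> nat) \<Rightarrow> bool" where
  "computes_det_in_time D \<tau> \<longleftrightarrow>
    (\<exists>K. \<forall>r\<ge>1. \<forall>A \<in> carrier_mat r r. \<exists>tr s.
       exec (word_bound K r) D (init_state r (mat_mem r A)) tr s \<and>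
       reg s 0 = of_bool (det A = 1) \<and> length tr \<le> \<tau> r)"

text \<open>The first argument accumulates the words printed since the last completed solution.\<close>

fun solutions :: "nat list \<Rightarrow> event list \<Rightarrow> nat list list" where
  "solutions ws [] = []"
| "solutions ws (Tick # tr) = solutions ws tr"
| "solutions ws (Printed w # tr) = solutions (ws @ [w]) tr"
| "solutions ws (Emitted # tr) = ws # solutions [] tr"

text \<open>
  The waiting times before the first solution, between consecutive solutions, and from the last
  solution to termination; the first argument is the time elapsed since the last solution.
\<close>

fun gaps :: "nat \<Rightarrow> event list \<Rightarrow> nat list" where
  "gaps t [] = [t]"
| "gaps t (Emitted # tr) = Suc t # gaps 0 tr"
| "gaps t (e # tr) = gaps (Suc t) tr"

definition delay :: "event list \<Rightarrow> nat" where
  "delay tr = Max (set (gaps 0 tr))"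

definition lin_indpt_sets :: "nat \<Rightarrow> bit vec set set" where
  "lin_indpt_sets r =
    {S. S \<subseteq> carrier_vec r \<and> card S = r \<and>
        \<not> module.lin_dep class_ring (module_vec TYPE(bit) r) S}"

text \<open>A set of \<open>r\<close> vectors is printed as \<open>r * r\<close> bits, one vector after the other, in any order.\<close>

definition is_code :: "nat \<Rightarrow> nat list \<Rightarrow> bool" where
  "is_code r ws \<longleftrightarrow> length ws = r * r \<and> set ws \<subseteq> {0, 1}"

definition decode :: "nat \<Rightarrow> nat list \<Rightarrow> bit vec set" where
  "decode r ws = (\<lambda>i. vec r (\<lambda>j. of_nat (ws ! (i * r + j)))) ` {..<r}"

definition enumerates_with_delay :: "com \<Rightarrow> nat \<Rightarrow> nat \<Rightarrow> nat \<Rightarrow> bool" where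
  "enumerates_with_delay E K r d \<longleftrightarrow>
    (\<exists>tr s. exec (word_bound K r) E (init_state r (\<lambda>_. 0)) tr s \<and>
       (\<forall>ws \<in> set (solutions [] tr). is_code r ws) \<and>
       distinct (map (decode r) (solutions [] tr)) \<and>
       set (map (decode r) (solutions [] tr)) = lin_indpt_sets r \<and>
       delay tr = d)"

end

theory Submission
  imports Defs
begin

text \<open>
  Write vectors over GF(2) as polynomials, ordered like binary numbers. Given a basis of GF(2)^(k+1), let \<open>v\<close> be its smallest
  element with coordinate \<open>k\<close> equal to 1, and add \<open>v\<close> to the other elements with this property.
  This leaves a basis \<open>S\<close> of GF(2)^k with a marked subset \<open>T\<close>, the vectors that were changed.
  Minimality of \<open>v\<close> says precisely that \<open>v\<close> vanishes at the leading position of every \<open>t\<close> in \<open>T\<close>,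
  because \<open>v < v + t\<close> iff this is so. Hence the bases of GF(2)^(k+1) correspond bijectively to the
  triples \<open>(S, v, T)\<close> with this property, and for every \<open>S\<close> and \<open>v\<close> the choice \<open>T = {}\<close> is possible.

  Iterating, a basis of GF(2)^r becomes a sequence of \<open>O(r\<^sup>2)\<close> bits in which 0 is always allowed
  and whether 1 is allowed depends only on the preceding bits: a search tree without dead ends. The
  next sequence in lexicographic order is obtained by setting the last possible 0 to 1 and clearing
  everything behind it, and recomputing the basis from the bits takes \<open>O(r\<^sup>3)\<close> steps.
\<close>

subsection \<open>Bases of GF(2)^(k+1) from bases of GF(2)^k\<close>

text \<open>The output consists of sets, so every basis must be reached along one canonical way of
  building it. Eliminating coordinate \<open>k\<close> with an arbitrary pivot would produce a basis
  once per choice; insisting on the smallest pivot removes the ambiguity at the price of a side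
  condition. The point is that this condition splits: it asks for
  \<open>coeff v (degree t) = 0\<close> separately for each marked \<open>t\<close>. Given
  \<open>S\<close> and \<open>v\<close>, every mark can therefore be decided on its own, and leaving
  a vector unmarked never fails. Hence clearing all later bits always leaves a valid sequence, and
  the time between two outputs is bounded by one recomputation and one scan. Polynomials over
  \<open>bit\<close> serve as vectors because the spaces for all \<open>k\<close> then lie in one
  type, each inside the next, and \<open>degree\<close> names the leading position.\<close>

definition indep_family :: "('i \<Rightarrow> bit poly) \<Rightarrow> 'i set \<Rightarrow> bool" where
  "indep_family x I \<longleftrightarrow> finite I \<and>
     (\<forall>a. (\<Sum>i\<in>I. Polynomial.smult (a i) (x i)) = 0 \<longrightarrow> (\<forall>i\<in>I. a i = 0))"

text \<open>Independence together with the cardinality \<open>k\<close> stands in for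
  spanning.\<close>

definition gf2_bases :: "nat \<Rightarrow> bit poly set set" where
  "gf2_bases k = {S. indep_family id S \<and> card S = k \<and> (\<forall>p\<in>S. \<forall>j\<ge>k. coeff p j = 0)}"

definition extend_basis :: "bit poly \<Rightarrow> bit poly set \<Rightarrow> bit poly set \<Rightarrow> bit poly set" where
  "extend_basis v T S = insert v ((\<lambda>t. if t \<in> T then t + v else t) ` S)"

definition pivot_at :: "nat \<Rightarrow> bit poly \<Rightarrow> bool" where
  "pivot_at k v \<longleftrightarrow> coeff v k = 1 \<and> (\<forall>j>k. coeff v j = 0)"

section \<open>Characteristic 2, linear independence and elimination of one coordinate\<close>

lemma bit_poly_two [simp]: "(2 :: bit poly) = 0"
  by (simp add: numeral_poly)

lemma bit_poly_double [simp]: "p + p = (0 :: bit poly)"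
  using mult_2[of p] by simp

lemma bit_poly_add_cancel [simp]: "p + v + v = (p :: bit poly)"
  by (simp add: add.assoc)

lemma bit_poly_add_eq_0_iff: "p + q = 0 \<longleftrightarrow> p = (q :: bit poly)"
  by (metis add_right_cancel bit_poly_double)

lemma indep_familyD:
  "indep_family x I \<Longrightarrow> (\<Sum>i\<in>I. Polynomial.smult (a i) (x i)) = 0 \<Longrightarrow> i \<in> I \<Longrightarrow> a i = 0"
  unfolding indep_family_def by blast

text \<open>Two equal members would cancel in characteristic 2. This is the reason for working with
  families: once a transformed family is independent, the cardinality of its image comes for
  free.\<close>

lemma indep_family_inj_on:
  assumes "indep_family x I"
  shows "inj_on x I"
proof (rule inj_onI, rule ccontr)
  fix p q assume pq: "p \<in> I" "q \<in> I" "x p = x q" "p \<noteq> q"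
  have fin: "finite I" using assms by (simp add: indep_family_def)
  have "(\<Sum>i\<in>I. Polynomial.smult (of_bool (i \<in> {p, q})) (x i)) = (\<Sum>i\<in>{p, q}. x i)"
    using fin pq by (intro sum.mono_neutral_cong_right) auto
  also have "\<dots> = 0" using pq by simp
  finally have "(\<Sum>i\<in>I. Polynomial.smult (of_bool (i \<in> {p, q})) (x i)) = 0" .
  from indep_familyD[OF assms this pq(1)] show False by simp
qed

lemma indep_family_image:
  assumes "indep_family x I"
  shows "indep_family id (x ` I)"
  unfolding indep_family_def
proof (intro conjI allI impI)
  show "finite (x ` I)" using assms by (simp add: indep_family_def)
  fix a :: "bit poly \<Rightarrow> bit"
  assume "(\<Sum>p\<in>x ` I. Polynomial.smult (a p) (id p)) = 0"
  then have "(\<Sum>i\<in>I. Polynomial.smult (a (x i)) (x i)) = 0"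
    using indep_family_inj_on[OF assms] by (simp add: sum.reindex)
  from indep_familyD[OF assms this] show "\<forall>p\<in>x ` I. a p = 0" by blast
qed

lemma indep_zero_notin:
  assumes "indep_family id S"
  shows "0 \<notin> S"
proof
  assume "0 \<in> S"
  have "(\<Sum>i\<in>S. Polynomial.smult (of_bool (i = 0)) (id i)) = 0"
    by (intro sum.neutral) auto
  from indep_familyD[OF assms this \<open>0 \<in> S\<close>] show False by simp
qed

text \<open>The index \<open>0\<close>, which cannot lie in \<open>S\<close>, stands for the new vector.\<close>

lemma indep_family_extend:
  assumes S: "indep_family id S" and low: "\<forall>p\<in>S. coeff p k = 0" and v: "coeff v k = 1"
  shows "indep_family (\<lambda>p. if p = 0 then v else if p \<in> T then p + v else p) (insert 0 S)"
  unfolding indep_family_def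
proof (intro conjI allI impI)
  have fin: "finite S" using S by (simp add: indep_family_def)
  then show "finite (insert 0 S)" by simp
  have nz: "0 \<notin> S" by (rule indep_zero_notin[OF S])
  fix a :: "bit poly \<Rightarrow> bit"
  let ?x = "\<lambda>p. if p = 0 then v else if p \<in> T then p + v else p"
  \<comment> \<open>\<open>b\<close> is the total coefficient of \<open>v\<close> after regrouping.
    At coordinate \<open>k\<close> only \<open>v\<close> is nonzero, which forces
    \<open>b = 0\<close> and leaves a relation among \<open>S\<close>.\<close>
  define b where "b = a 0 + (\<Sum>p\<in>S. a p * of_bool (p \<in> T))"
  assume 0: "(\<Sum>p\<in>insert 0 S. Polynomial.smult (a p) (?x p)) = 0"
  have "(\<Sum>p\<in>insert 0 S. Polynomial.smult (a p) (?x p)) = Polynomial.smult (a 0) v + (\<Sum>p\<in>S. Polynomial.smult (a p) (?x p))"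
    using fin nz by simp
  also have "(\<Sum>p\<in>S. Polynomial.smult (a p) (?x p))
      = (\<Sum>p\<in>S. Polynomial.smult (a p) p + Polynomial.smult (a p * of_bool (p \<in> T)) v)"
    using nz by (intro sum.cong) (auto simp: smult_add_right)
  also have "\<dots> = (\<Sum>p\<in>S. Polynomial.smult (a p) p) + Polynomial.smult (\<Sum>p\<in>S. a p * of_bool (p \<in> T)) v"
    by (simp add: sum.distrib smult_sum)
  finally have "Polynomial.smult (a 0) v + ((\<Sum>p\<in>S. Polynomial.smult (a p) p)
      + Polynomial.smult (\<Sum>p\<in>S. a p * of_bool (p \<in> T)) v) = 0"
    unfolding 0 by (rule sym)
  then have eq: "(\<Sum>p\<in>S. Polynomial.smult (a p) p) + Polynomial.smult b v = 0"
    unfolding b_def smult_add_left by (simp only: ac_simps)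
  have "coeff (\<Sum>p\<in>S. Polynomial.smult (a p) p) k = 0"
    using low by (auto simp: coeff_sum intro: sum.neutral)
  with arg_cong[OF eq, of "\<lambda>p. coeff p k"] have b: "b = 0" using v by simp
  with eq have "(\<Sum>p\<in>S. Polynomial.smult (a p) (id p)) = 0" by simp
  from indep_familyD[OF S this] have a: "\<forall>p\<in>S. a p = 0" by blast
  then have "a 0 = 0" using b by (simp add: b_def)
  with a show "\<forall>p\<in>insert 0 S. a p = 0" by simp
qed

text \<open>A relation among the reduced vectors is a relation of \<open>S\<close> itself in which
  \<open>v\<close> receives the collected coefficient \<open>b\<close> and all other coefficients
  are unchanged.\<close>

lemma indep_family_reduce:
  assumes S: "indep_family id S" and v: "v \<in> S" "coeff v k = 1"
  shows "indep_family (\<lambda>p. if coeff p k = 1 then p + v else p) (S - {v})"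
  unfolding indep_family_def
proof (intro conjI allI impI)
  have fin: "finite S" using S by (simp add: indep_family_def)
  then show "finite (S - {v})" by simp
  fix a :: "bit poly \<Rightarrow> bit"
  let ?x = "\<lambda>p. if coeff p k = 1 then p + v else p"
  define b where "b = (\<Sum>p\<in>S - {v}. a p * of_bool (coeff p k = 1))"
  assume 0: "(\<Sum>p\<in>S - {v}. Polynomial.smult (a p) (?x p)) = 0"
  have "(\<Sum>p\<in>S - {v}. Polynomial.smult (a p) (?x p))
      = (\<Sum>p\<in>S - {v}. Polynomial.smult (a p) p + Polynomial.smult (a p * of_bool (coeff p k = 1)) v)"
    by (intro sum.cong) (auto simp: smult_add_right)
  also have "\<dots> = (\<Sum>p\<in>S - {v}. Polynomial.smult (a p) p) + Polynomial.smult b v"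
    by (simp add: sum.distrib smult_sum b_def)
  also have "\<dots> = (\<Sum>p\<in>S. Polynomial.smult ((a(v := b)) p) (id p))"
    using fin v by (simp add: sum.remove[of S v] add.commute)
  finally have "(\<Sum>p\<in>S. Polynomial.smult ((a(v := b)) p) (id p)) = 0" using 0 by simp
  from indep_familyD[OF S this] show "\<forall>p\<in>S - {v}. a p = 0" by (metis DiffE fun_upd_apply singletonI)
qed

text \<open>Gaussian elimination, one coordinate per induction step. The bound is what guarantees
  that a basis of the next dimension contains a candidate for the pivot.\<close>

lemma indep_card_le:
  assumes "indep_family id S" "\<forall>p\<in>S. \<forall>j\<ge>k. coeff p j = 0"
  shows "card S \<le> k"
  using assms
proof (induction k arbitrary: S)
  case 0
  have "p = 0" if "p \<in> S" for p using 0(2) that by (intro poly_eqI) simp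
  then have "S = {}" using indep_zero_notin[OF 0(1)] by blast
  then show ?case by simp
next
  case (Suc k)
  show ?case
  proof (cases "\<exists>v\<in>S. coeff v k = 1")
    case True
    then obtain v where v: "v \<in> S" "coeff v k = 1" by blast
    let ?x = "\<lambda>p. if coeff p k = 1 then p + v else p"
    note red = indep_family_reduce[OF Suc.prems(1) v]
    have fin: "finite S" using Suc.prems(1) by (simp add: indep_family_def)
    have "\<forall>p\<in>?x ` (S - {v}). \<forall>j\<ge>k. coeff p j = 0"
    proof (intro ballI allI impI)
      fix p j assume "p \<in> ?x ` (S - {v})" "k \<le> j"
      then show "coeff p j = 0" using Suc.prems(2) v by (cases "j = k") auto
    qed
    from Suc.IH[OF indep_family_image[OF red] this]
    have "card (S - {v}) \<le> k" using card_image[OF indep_family_inj_on[OF red]] by simp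
    then show ?thesis using fin v by simp
  next
    case False
    have "\<forall>p\<in>S. \<forall>j\<ge>k. coeff p j = 0"
    proof (intro ballI allI impI)
      fix p j assume "p \<in> S" "k \<le> j"
      then show "coeff p j = 0" using Suc.prems(2) False by (cases "j = k") auto
    qed
    from Suc.IH[OF Suc.prems(1) this] show ?thesis by simp
  qed
qed

lemma extend_basis_in_bases:
  assumes "S \<in> gf2_bases k" "pivot_at k v"
  shows "extend_basis v T S \<in> gf2_bases (Suc k)"
proof -
  have S: "indep_family id S" "card S = k" "\<forall>p\<in>S. \<forall>j\<ge>k. coeff p j = 0"
    using assms by (auto simp: gf2_bases_def)
  have v: "coeff v k = 1" "\<forall>j>k. coeff v j = 0" using assms by (auto simp: pivot_at_def)
  let ?x = "\<lambda>p. if p = 0 then v else if p \<in> T then p + v else p"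
  have nz: "0 \<notin> S" by (rule indep_zero_notin[OF S(1)])
  have fin: "finite S" using S(1) by (simp add: indep_family_def)
  have fam: "indep_family ?x (insert 0 S)"
    by (rule indep_family_extend) (use S v in auto)
  have img: "?x ` insert 0 S = extend_basis v T S"
    using nz by (auto simp: extend_basis_def image_iff)
  have "card (extend_basis v T S) = Suc k"
    using card_image[OF indep_family_inj_on[OF fam]] fin nz S(2) unfolding img by simp
  moreover have "\<forall>p\<in>extend_basis v T S. \<forall>j\<ge>Suc k. coeff p j = 0"
    using S(3) v(2) by (auto simp: extend_basis_def)
  ultimately show ?thesis using indep_family_image[OF fam] img by (simp add: gf2_bases_def)
qed

text \<open>
  Reading polynomials as binary numbers, \<open>coeff p (degree (p + q)) = 0\<close> says that \<open>p\<close> is smaller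
  than \<open>q\<close> (for \<open>p \<noteq> q\<close>).
\<close>

lemma coeff_degree_sum_trans:
  fixes p q s :: "bit poly"
  assumes "p \<noteq> q" "q \<noteq> s" "coeff p (degree (p + q)) = 0" "coeff q (degree (q + s)) = 0"
  shows "p \<noteq> s" "coeff p (degree (p + s)) = 0"
proof -
  have eq: "p + s = (p + q) + (q + s)" by (metis add.assoc bit_poly_add_cancel)
  have "coeff (p + q) (degree (p + q)) \<noteq> 0"
    unfolding leading_coeff_0_iff using assms(1) by (simp add: bit_poly_add_eq_0_iff)
  with assms(3) have q1: "coeff q (degree (p + q)) = 1" by simp
  \<comment> \<open>The two leading positions differ because \<open>q\<close> has a 1 at the first
    and a 0 at the second. The leading position of \<open>p + s\<close> is therefore the larger of
    the two.\<close>
  then have ne: "degree (p + q) \<noteq> degree (q + s)" using assms(4) by auto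
  then show "p \<noteq> s" by (auto simp: add.commute)
  show "coeff p (degree (p + s)) = 0"
  proof (cases "degree (p + q) < degree (q + s)")
    case True
    then have d: "degree (p + s) = degree (q + s)" unfolding eq by (rule degree_add_eq_right)
    have "coeff (p + q) (degree (q + s)) = 0" using True by (rule coeff_eq_0)
    then show ?thesis using assms(4) d by simp
  next
    case False
    with ne have "degree (p + s) = degree (p + q)"
      unfolding eq by (intro degree_add_eq_left) simp
    then show ?thesis using assms(3) by simp
  qed
qed

lemma smallest_poly_exists:
  fixes A :: "bit poly set"
  assumes "finite A" "A \<noteq> {}"
  shows "\<exists>v\<in>A. \<forall>p\<in>A - {v}. coeff v (degree (v + p)) = 0"
  using assms
proof (induction rule: finite_ne_induct)
  case (singleton x)
  then show ?case by simp
next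
  case (insert x F)
  then obtain v where v: "v \<in> F" "\<forall>p\<in>F - {v}. coeff v (degree (v + p)) = 0" by blast
  have xv: "x \<noteq> v" using v insert by auto
  show ?case
  proof (cases "coeff v (degree (v + x)) = 0")
    case True
    then show ?thesis using v by blast
  next
    case False
    \<comment> \<open>Exactly one of \<open>x\<close> and \<open>v\<close> has a 1 at the highest
      position where they differ, so if \<open>v\<close> is not the smaller one, \<open>x\<close>
      is.\<close>
    moreover have "coeff (x + v) (degree (x + v)) \<noteq> 0"
      unfolding leading_coeff_0_iff using xv by (simp add: bit_poly_add_eq_0_iff)
    ultimately have x: "coeff x (degree (x + v)) = 0" by (auto simp: add.commute)
    have "coeff x (degree (x + p)) = 0" if "p \<in> F" for p
      using coeff_degree_sum_trans(2)[of x v p] x xv v that by (cases "p = v") auto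
    then show ?thesis by blast
  qed
qed

lemma smallest_poly_unique:
  fixes v v' :: "bit poly"
  assumes "v \<in> A" "v' \<in> A" "\<forall>p\<in>A - {v}. coeff v (degree (v + p)) = 0"
    "\<forall>p\<in>A - {v'}. coeff v' (degree (v' + p)) = 0"
  shows "v = v'"
proof (rule ccontr)
  assume ne: "v \<noteq> v'"
  then have "coeff v (degree (v + v')) = 0" "coeff v' (degree (v' + v)) = 0"
    using assms by auto
  then have "coeff (v + v') (degree (v + v')) = 0" by (simp add: add.commute)
  then show False
    unfolding leading_coeff_0_iff using ne by (simp add: bit_poly_add_eq_0_iff)
qed

text \<open>Since \<open>v + (t + v) = t\<close>, comparing \<open>v\<close> with
  \<open>t + v\<close> means looking at \<open>v\<close> in the leading position of
  \<open>t\<close>: the condition on \<open>T\<close> is precisely minimality of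
  \<open>v\<close>.\<close>

lemma smallest_in_extend_basis:
  assumes low: "\<forall>t\<in>S. \<forall>j\<ge>k. coeff t j = 0" and v: "pivot_at k v" and "T \<subseteq> S"
    and T: "\<forall>t\<in>T. coeff v (degree t) = 0"
  shows "{p \<in> extend_basis v T S. coeff p k = 1} = insert v ((\<lambda>t. t + v) ` T)"
    and "\<forall>p\<in>{p \<in> extend_basis v T S. coeff p k = 1} - {v}. coeff v (degree (v + p)) = 0"
proof -
  show eq: "{p \<in> extend_basis v T S. coeff p k = 1} = insert v ((\<lambda>t. t + v) ` T)"
    using low v \<open>T \<subseteq> S\<close> by (fastforce simp: extend_basis_def pivot_at_def)
  show "\<forall>p\<in>{p \<in> extend_basis v T S. coeff p k = 1} - {v}. coeff v (degree (v + p)) = 0"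
    unfolding eq using T by (auto simp: add.commute add.left_commute)
qed

text \<open>Everything can be read off the extended basis: \<open>v\<close> is its smallest element
  with coordinate \<open>k\<close>, \<open>T\<close> arises by adding \<open>v\<close> to the other
  elements with that coordinate, and \<open>S\<close> is \<open>T\<close> together with the elements
  lacking it.\<close>

lemma extend_basis_inject:
  assumes S: "S \<in> gf2_bases k" and v: "pivot_at k v" and T: "T \<subseteq> S" "\<forall>t\<in>T. coeff v (degree t) = 0"
    and S': "S' \<in> gf2_bases k" and v': "pivot_at k v'" and T': "T' \<subseteq> S'" "\<forall>t\<in>T'. coeff v' (degree t) = 0"
    and eq: "extend_basis v T S = extend_basis v' T' S'"
  shows "v = v'" "T = T'" "S = S'"
proof -
  have low: "\<forall>t\<in>S. \<forall>j\<ge>k. coeff t j = 0" "\<forall>t\<in>S'. \<forall>j\<ge>k. coeff t j = 0"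
    using S S' by (auto simp: gf2_bases_def)
  have nz: "0 \<notin> S" "0 \<notin> S'" using S S' indep_zero_notin by (auto simp: gf2_bases_def)
  note sm = smallest_in_extend_basis[OF low(1) v T]
  note sm' = smallest_in_extend_basis[OF low(2) v' T', folded eq]
  show vv: "v = v'"
    by (rule smallest_poly_unique[OF _ _ sm(2) sm'(2)]) (use sm(1) sm'(1) in auto)
  have rec: "U = (\<lambda>p. p + w) ` ({p \<in> extend_basis w U R. coeff p k = 1} - {w})"
    "R = U \<union> {p \<in> extend_basis w U R. coeff p k \<noteq> 1}"
    if R: "\<forall>t\<in>R. \<forall>j\<ge>k. coeff t j = 0" "0 \<notin> R" and w: "pivot_at k w" and U: "U \<subseteq> R"
      "\<forall>t\<in>U. coeff w (degree t) = 0" for R w U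
  proof -
    have "w \<notin> (\<lambda>t. t + w) ` U" using R U by auto
    then have "insert w ((\<lambda>t. t + w) ` U) - {w} = (\<lambda>t. t + w) ` U" by blast
    then show "U = (\<lambda>p. p + w) ` ({p \<in> extend_basis w U R. coeff p k = 1} - {w})"
      unfolding smallest_in_extend_basis(1)[OF R(1) w U] by (simp add: image_image)
    show "R = U \<union> {p \<in> extend_basis w U R. coeff p k \<noteq> 1}"
      using R w U by (fastforce simp: extend_basis_def pivot_at_def)
  qed
  show TT: "T = T'"
    using rec(1)[OF low(1) nz(1) v T] rec(1)[OF low(2) nz(2) v' T'] eq vv by simp
  show "S = S'"
    using rec(2)[OF low(1) nz(1) v T] rec(2)[OF low(2) nz(2) v' T'] eq vv TT by simp
qed

text \<open>If no element had coordinate \<open>k\<close>, there would be \<open>k + 1\<close>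
  independent vectors in GF(2)^k. So a smallest such element exists and can be eliminated.\<close>

lemma extend_basis_exists:
  assumes "B \<in> gf2_bases (Suc k)"
  obtains v T S where "S \<in> gf2_bases k" "pivot_at k v" "T \<subseteq> S"
    "\<forall>t\<in>T. coeff v (degree t) = 0" "B = extend_basis v T S"
proof -
  have B: "indep_family id B" "card B = Suc k" "\<forall>p\<in>B. \<forall>j\<ge>Suc k. coeff p j = 0"
    using assms by (auto simp: gf2_bases_def)
  have fin: "finite B" using B(1) by (simp add: indep_family_def)
  define A where "A = {p \<in> B. coeff p k = 1}"
  have "A \<noteq> {}"
  proof
    assume "A = {}"
    then have "\<forall>p\<in>B. coeff p k = 0" by (auto simp: A_def)
    then have "\<forall>p\<in>B. \<forall>j\<ge>k. coeff p j = 0" using B(3) by (metis Suc_leI le_neq_implies_less)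
    from indep_card_le[OF B(1) this] B(2) show False by simp
  qed
  then obtain v where v: "v \<in> A" "\<forall>p\<in>A - {v}. coeff v (degree (v + p)) = 0"
    using smallest_poly_exists[of A] fin by (auto simp: A_def)
  have vB: "v \<in> B" "coeff v k = 1" using v(1) by (auto simp: A_def)
  let ?g = "\<lambda>p. if coeff p k = 1 then p + v else p"
  define S where "S = ?g ` (B - {v})"
  define T where "T = (\<lambda>p. p + v) ` (A - {v})"
  note red = indep_family_reduce[OF B(1) vB]
  have low: "\<forall>p\<in>S. \<forall>j\<ge>k. coeff p j = 0"
  proof (intro ballI allI impI)
    fix p j assume "p \<in> S" "k \<le> j"
    then show "coeff p j = 0" using B(3) vB by (cases "j = k") (auto simp: S_def)
  qed
  have "card S = k"
    using card_image[OF indep_family_inj_on[OF red]] fin vB B(2) by (simp add: S_def)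
  moreover have "indep_family id S" unfolding S_def by (rule indep_family_image[OF red])
  ultimately have 1: "S \<in> gf2_bases k" using low by (simp add: gf2_bases_def)
  have 2: "pivot_at k v" using vB B(3) by (auto simp: pivot_at_def)
  have 3: "T \<subseteq> S" by (auto simp: S_def T_def A_def)
  have 4: "\<forall>t\<in>T. coeff v (degree t) = 0" using v(2) by (auto simp: T_def add.commute)
  \<comment> \<open>Membership in \<open>T\<close> must reveal whether a vector was changed. A
    changed and an unchanged vector could only be confused if they became equal, which injectivity
    of the reduced family excludes.\<close>
  have T: "?g p \<in> T \<longleftrightarrow> coeff p k = 1" if "p \<in> B - {v}" for p
  proof
    assume "?g p \<in> T"
    show "coeff p k = 1"
    proof (rule ccontr)
      assume "coeff p k \<noteq> 1"
      with \<open>?g p \<in> T\<close> obtain q where q: "q \<in> A - {v}" "p = q + v" by (auto simp: T_def)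
      then have "?g p = ?g q" using \<open>coeff p k \<noteq> 1\<close> by (auto simp: A_def)
      then have "p = q"
        using indep_family_inj_on[OF red] that q(1) unfolding inj_on_def A_def by blast
      then show False using \<open>coeff p k \<noteq> 1\<close> q by (simp add: A_def)
    qed
  qed (use that in \<open>auto simp: T_def A_def\<close>)
  have "(if ?g p \<in> T then ?g p + v else ?g p) = p" if "p \<in> B - {v}" for p
    using T[OF that] by auto
  then have "(\<lambda>t. if t \<in> T then t + v else t) ` S = B - {v}"
    unfolding S_def image_image by simp
  then have "B = extend_basis v T S" using vB by (auto simp: extend_basis_def)
  with 1 2 3 4 show thesis by (rule that)
qed

subsection \<open>Codes of bases\<close>

text \<open>
  A code is a sequence of \<open>2r\<close> rows of \<open>r\<close> bits. Row \<open>2k\<close> holds the coordinates below \<open>k\<close> of the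
  \<open>k\<close>-th pivot \<open>v\<close>, row \<open>2k + 1\<close> says to which of the earlier vectors \<open>v\<close> is added. The bit at
  position \<open>p\<close> may be 1 iff \<open>cap r c p = 1\<close>, which depends only on the bits before \<open>p\<close>.
\<close>

definition pivot_row :: "nat \<Rightarrow> (nat \<Rightarrow> nat) \<Rightarrow> nat \<Rightarrow> bit poly" where
  "pivot_row r c k = Poly (map (\<lambda>j. of_nat (c (2 * k * r + j))) [0..<k] @ [1])"

text \<open>Meaningful for \<open>i < k\<close> only: vector \<open>i\<close> is born as the pivot
  of level \<open>i\<close> and then modified by every later pivot whose mark selects it. The 0 at
  level 0 is a dummy.\<close>

fun code_rows :: "nat \<Rightarrow> (nat \<Rightarrow> nat) \<Rightarrow> nat \<Rightarrow> nat \<Rightarrow> bit poly" where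
  "code_rows r c 0 i = 0"
| "code_rows r c (Suc k) i =
    (if i = k then pivot_row r c k
     else if c ((2 * k + 1) * r + i) = 1 then code_rows r c k i + pivot_row r c k
     else code_rows r c k i)"

definition cap :: "nat \<Rightarrow> (nat \<Rightarrow> nat) \<Rightarrow> nat \<Rightarrow> nat" where
  "cap r c p =
    (let k = p div r div 2; i = p mod r
     in of_bool (i < k \<and> (odd (p div r) \<longrightarrow>
          coeff (pivot_row r c k) (degree (code_rows r c k i)) = 0)))"

definition codes :: "nat \<Rightarrow> nat \<Rightarrow> (nat \<Rightarrow> nat) set" where
  "codes r k = {c. (\<forall>p<2 * k * r. c p \<le> cap r c p) \<and> (\<forall>p\<ge>2 * k * r. c p = 0)}"

section \<open>Dependence of vectors and caps on the preceding bits\<close>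

lemma coeff_pivot_row:
  "coeff (pivot_row r c k) j =
    (if j < k then of_nat (c (2 * k * r + j)) else of_bool (j = k))"
  by (auto simp: pivot_row_def coeff_Poly_eq nth_default_def nth_append)

lemma pivot_at_pivot_row: "pivot_at k (pivot_row r c k)"
  by (simp add: pivot_at_def coeff_pivot_row)

lemma pivot_row_cong:
  assumes "\<And>j. j < k \<Longrightarrow> c (2 * k * r + j) = d (2 * k * r + j)"
  shows "pivot_row r c k = pivot_row r d k"
  unfolding pivot_row_def using assms by (intro arg_cong[of _ _ Poly]) simp

lemma code_rows_cong:
  assumes "\<And>p. p < 2 * k * r \<Longrightarrow> c p = d p" "k \<le> r" "i < k"
  shows "code_rows r c k i = code_rows r d k i"
  using assms
proof (induction k arbitrary: i)
  case (Suc k)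
  have "c (2 * k * r + j) = d (2 * k * r + j)" if "j < k" for j
    using Suc.prems that by (intro Suc.prems(1)) simp
  then have pivot: "pivot_row r c k = pivot_row r d k" by (rule pivot_row_cong)
  have "c ((2 * k + 1) * r + i) = d ((2 * k + 1) * r + i)"
    using Suc.prems by (intro Suc.prems(1)) simp
  moreover have "code_rows r c k i = code_rows r d k i" if "i \<noteq> k"
    using Suc.prems that by (intro Suc.IH) auto
  ultimately show ?case using pivot by simp
qed simp

lemma cap_even_row: "j < r \<Longrightarrow> cap r c (2 * k * r + j) = of_bool (j < k)"
  by (simp add: cap_def)

lemma cap_odd_row:
  assumes "i < r"
  shows "cap r c ((2 * k + 1) * r + i) =
    of_bool (i < k \<and> coeff (pivot_row r c k) (degree (code_rows r c k i)) = 0)"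
proof -
  have "((2 * k + 1) * r + i) div r = 2 * k + 1" "((2 * k + 1) * r + i) mod r = i"
    using assms by (simp_all only: div_mult_self3 mod_mult_self3, simp_all)
  then show ?thesis unfolding cap_def Let_def by simp
qed

lemma code_index_cases:
  fixes p r k :: nat
  assumes "p < 2 * Suc k * r"
  obtains "p < 2 * k * r" | j where "j < r" "p = 2 * k * r + j"
    | j where "j < r" "p = (2 * k + 1) * r + j"
proof (cases "p < 2 * k * r")
  case False
  then obtain q where q: "p = 2 * k * r + q" using le_Suc_ex not_less by metis
  show ?thesis
  proof (cases "q < r")
    case False
    then obtain j where "q = r + j" using le_Suc_ex not_less by metis
    then show ?thesis using assms q by (intro that(3)[of j]) (simp_all add: algebra_simps)
  qed (use q that in blast)
qed (use that in blast)

text \<open>A cap in row \<open>2 * k + 1\<close> consults the pivot in row \<open>2 * k\<close> and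
  the vectors of level \<open>k\<close>, which are determined by the rows below
  \<open>2 * k\<close>; it never looks at marks in its own row. Lexicographic search rests on
  this.\<close>

lemma cap_cong:
  assumes "\<And>q. q < p \<Longrightarrow> c q = d q" "p < 2 * r * r"
  shows "cap r c p = cap r d p"
proof -
  define k where "k = p div r div 2"
  have r: "0 < r" using assms(2) by (cases r) auto
  have "p div r < 2 * r" using assms(2) by (simp add: less_mult_imp_div_less)
  then have kr: "k < r" by (simp add: k_def)
  have p: "p = p div r * r + p mod r" by simp
  show ?thesis
  proof (cases "even (p div r)")
    case True
    then show ?thesis by (simp add: cap_def)
  next
    case False
    then have "p div r = 2 * k + 1" by (simp add: k_def)
    with p have pe: "p = (2 * k + 1) * r + p mod r" by simp
    have ir: "p mod r < r" using r by simp
    have "pivot_row r c k = pivot_row r d k"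
      using kr by (intro pivot_row_cong assms(1)) (subst pe, simp)
    moreover have "code_rows r c k i = code_rows r d k i" if "i < k" for i
    proof (rule code_rows_cong)
      fix q assume "q < 2 * k * r"
      then have "q < p" by (subst pe) simp
      then show "c q = d q" by (rule assms(1))
    qed (use kr that in auto)
    ultimately show ?thesis
      by (subst (1 2) pe) (auto simp only: cap_odd_row[OF ir] of_bool_eq_iff)
  qed
qed

lemma cap_le_1: "cap r c p \<le> 1"
  by (simp add: cap_def Let_def)

text \<open>Codes mark indices while \<open>extend_basis\<close> marks vectors; injectivity makes
  the two agree.\<close>

lemma code_rows_Suc_image:
  assumes "inj_on (code_rows r c k) {..<k}"
  shows "code_rows r c (Suc k) ` {..<Suc k} = extend_basis (pivot_row r c k)
    (code_rows r c k ` {i. i < k \<and> c ((2 * k + 1) * r + i) = 1}) (code_rows r c k ` {..<k})"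
    (is "_ = extend_basis ?v ?T _")
proof -
  have "code_rows r c k i \<in> ?T \<longleftrightarrow> c ((2 * k + 1) * r + i) = 1" if "i < k" for i
    using assms that by (auto dest: inj_onD)
  then have "code_rows r c (Suc k) ` {..<k} =
      (\<lambda>t. if t \<in> ?T then t + ?v else t) ` code_rows r c k ` {..<k}"
    unfolding image_image by (intro image_cong refl) (simp del: image_iff)
  then show ?thesis unfolding lessThan_Suc extend_basis_def image_insert by simp
qed

text \<open>Caps look backwards only, so truncation preserves validity. This supplies the induction
  hypotheses on the level.\<close>

lemma codes_restrict:
  assumes "c \<in> codes r m" "k \<le> m" "k \<le> r"
  defines "c0 \<equiv> \<lambda>p. if p < 2 * k * r then c p else 0"
  shows "c0 \<in> codes r k" "i < k \<Longrightarrow> code_rows r c0 k i = code_rows r c k i"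
proof -
  have "cap r c0 p = cap r c p" if "p < 2 * k * r" for p
  proof (rule cap_cong)
    have "2 * k * r \<le> 2 * r * r" using assms(3) by (intro mult_right_mono) auto
    with that show "p < 2 * r * r" by (rule less_le_trans)
  qed (use that in \<open>simp add: c0_def\<close>)
  moreover have "p < 2 * m * r" if "p < 2 * k * r" for p
    using that assms(2) by (elim less_le_trans) (intro mult_right_mono, auto)
  ultimately show "c0 \<in> codes r k" using assms(1) by (auto simp: codes_def c0_def)
  show "code_rows r c0 k i = code_rows r c k i" if "i < k"
    by (rule code_rows_cong) (use assms(3) that in \<open>auto simp: c0_def\<close>)
qed

lemma code_rows_bases:
  assumes "c \<in> codes r k" "k \<le> r"
  shows "code_rows r c k ` {..<k} \<in> gf2_bases k" "inj_on (code_rows r c k) {..<k}"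
proof -
  have "code_rows r c k ` {..<k} \<in> gf2_bases k \<and> inj_on (code_rows r c k) {..<k}"
    using assms
  proof (induction k arbitrary: c)
    case 0
    then show ?case by (simp add: gf2_bases_def indep_family_def)
  next
    case (Suc k)
    let ?c0 = "\<lambda>p. if p < 2 * k * r then c p else 0"
    have "k < r" using Suc.prems by simp
    note c0 = codes_restrict[OF Suc.prems(1) lessI[THEN less_imp_le] less_imp_le[OF this]]
    have img: "code_rows r ?c0 k ` {..<k} = code_rows r c k ` {..<k}" using c0(2) by simp
    have "inj_on (code_rows r ?c0 k) {..<k} \<longleftrightarrow> inj_on (code_rows r c k) {..<k}"
      by (rule inj_on_cong) (use c0(2) in simp)
    with Suc.IH[OF c0(1)] \<open>k < r\<close> img
    have IH: "code_rows r c k ` {..<k} \<in> gf2_bases k" "inj_on (code_rows r c k) {..<k}"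
      by simp_all
    have "code_rows r c (Suc k) ` {..<Suc k} \<in> gf2_bases (Suc k)"
      unfolding code_rows_Suc_image[OF IH(2)]
      by (rule extend_basis_in_bases[OF IH(1) pivot_at_pivot_row])
    moreover from this have "card (code_rows r c (Suc k) ` {..<Suc k}) = card {..<Suc k}"
      by (simp add: gf2_bases_def)
    \<comment> \<open>Injectivity comes from counting: \<open>Suc k\<close> indices yield a set of
      \<open>Suc k\<close> vectors.\<close>
    then have "inj_on (code_rows r c (Suc k)) {..<Suc k}" by (intro eq_card_imp_inj_on) auto
    ultimately show ?case by blast
  qed
  then show "code_rows r c k ` {..<k} \<in> gf2_bases k" "inj_on (code_rows r c k) {..<k}" by auto
qed

text \<open>Ensures that each vector has a leading 1 below position \<open>k\<close>, on which the
  program's scan for that position relies.\<close>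

lemma code_rows_level:
  assumes "c \<in> codes r r" "k \<le> r" "i < k"
  shows "code_rows r c k i \<noteq> 0" "j \<ge> k \<Longrightarrow> coeff (code_rows r c k i) j = 0"
proof -
  note c0 = codes_restrict[OF assms(1,2,2)]
  have "code_rows r c k ` {..<k} \<in> gf2_bases k"
    using code_rows_bases(1)[OF c0(1) assms(2)] c0(2) by simp
  then show "code_rows r c k i \<noteq> 0" "j \<ge> k \<Longrightarrow> coeff (code_rows r c k i) j = 0"
    using indep_zero_notin assms(3) by (fastforce simp: gf2_bases_def)+
qed

lemma codes_SucD:
  assumes "c \<in> codes r (Suc k)" "k < r"
  shows "inj_on (code_rows r c k) {..<k}" "code_rows r c k ` {..<k} \<in> gf2_bases k"
    "\<forall>t \<in> code_rows r c k ` {i. i < k \<and> c ((2 * k + 1) * r + i) = 1}.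
       coeff (pivot_row r c k) (degree t) = 0"
    "j < r \<Longrightarrow> c (2 * k * r + j) \<le> of_bool (j < k)"
    "i < r \<Longrightarrow> c ((2 * k + 1) * r + i) \<le> of_bool (i < k)"
proof -
  let ?c0 = "\<lambda>p. if p < 2 * k * r then c p else 0"
  note c0 = codes_restrict[OF assms(1) lessI[THEN less_imp_le] less_imp_le[OF assms(2)]]
  have "k \<le> r" using assms by simp
  note cr = code_rows_bases[OF c0(1) this]
  have "inj_on (code_rows r ?c0 k) {..<k} \<longleftrightarrow> inj_on (code_rows r c k) {..<k}"
    by (rule inj_on_cong) (use c0(2) in simp)
  moreover have "code_rows r ?c0 k ` {..<k} = code_rows r c k ` {..<k}" using c0(2) by simp
  ultimately show "inj_on (code_rows r c k) {..<k}" "code_rows r c k ` {..<k} \<in> gf2_bases k"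
    using cr by simp_all
  have le: "c p \<le> cap r c p" if "p < 2 * Suc k * r" for p
    using assms(1) that by (simp add: codes_def)
  have odd: "c ((2 * k + 1) * r + i) \<le>
      of_bool (i < k \<and> coeff (pivot_row r c k) (degree (code_rows r c k i)) = 0)" if "i < r" for i
    using le[of "(2 * k + 1) * r + i"] that unfolding cap_odd_row[OF that] by simp
  show "c ((2 * k + 1) * r + i) \<le> of_bool (i < k)" if "i < r"
    using odd[OF that] by (rule order_trans) simp
  show "c (2 * k * r + j) \<le> of_bool (j < k)" if "j < r"
    using le[of "2 * k * r + j"] that unfolding cap_even_row[OF that] by simp
  show "\<forall>t \<in> code_rows r c k ` {i. i < k \<and> c ((2 * k + 1) * r + i) = 1}.
       coeff (pivot_row r c k) (degree t) = 0"
  proof safe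
    fix i assume "i < k" "c ((2 * k + 1) * r + i) = 1"
    then show "coeff (pivot_row r c k) (degree (code_rows r c k i)) = 0"
      using odd[of i] assms(2) by (auto split: if_splits simp: of_bool_def)
  qed
qed

text \<open>Injectivity of \<open>extend_basis\<close> peels off the last level: the pivot
  determines row \<open>2 * k\<close>, the set of marked vectors row \<open>2 * k + 1\<close>, and
  the remaining set the prefix by induction.\<close>

lemma code_rows_inject:
  assumes "c \<in> codes r k" "d \<in> codes r k" "k \<le> r"
    "code_rows r c k ` {..<k} = code_rows r d k ` {..<k}"
  shows "c = d"
  using assms
proof (induction k arbitrary: c d)
  case 0
  then show ?case by (auto simp: codes_def)
next
  case (Suc k)
  have kr: "k < r" using Suc.prems by simp
  note cS = codes_SucD[OF Suc.prems(1) kr] and dS = codes_SucD[OF Suc.prems(2) kr]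
  let ?Tc = "code_rows r c k ` {i. i < k \<and> c ((2 * k + 1) * r + i) = 1}"
  let ?Td = "code_rows r d k ` {i. i < k \<and> d ((2 * k + 1) * r + i) = 1}"
  have "extend_basis (pivot_row r c k) ?Tc (code_rows r c k ` {..<k}) =
      extend_basis (pivot_row r d k) ?Td (code_rows r d k ` {..<k})"
    using Suc.prems(4) unfolding code_rows_Suc_image[OF cS(1)] code_rows_Suc_image[OF dS(1)] .
  from extend_basis_inject[OF cS(2) pivot_at_pivot_row _ cS(3) dS(2) pivot_at_pivot_row _ dS(3) this]
  have eq: "pivot_row r c k = pivot_row r d k" "?Tc = ?Td"
    "code_rows r c k ` {..<k} = code_rows r d k ` {..<k}" by (auto simp only: image_mono)
  note c0 = codes_restrict[OF Suc.prems(1) lessI[THEN less_imp_le] less_imp_le[OF kr]] and d0 = codes_restrict[OF Suc.prems(2) lessI[THEN less_imp_le] less_imp_le[OF kr]]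
  have low: "(\<lambda>p. if p < 2 * k * r then c p else 0) = (\<lambda>p. if p < 2 * k * r then d p else 0)"
    by (rule Suc.IH[OF c0(1) d0(1)]) (use kr c0(2) d0(2) eq(3) in auto)
  then have low': "c p = d p" if "p < 2 * k * r" for p using that by (meson)
  \<comment> \<open>Equal prefixes make the vectors agree index by index and not merely as sets, so
    marks can be compared at the same index.\<close>
  have rows: "code_rows r c k i = code_rows r d k i" if "i < k" for i
    by (rule code_rows_cong) (use low' kr that in auto)
  show "c = d"
  proof
    fix p
    show "c p = d p"
    proof (cases "p < 2 * Suc k * r")
      case True
      then show ?thesis
      proof (cases rule: code_index_cases)
        case 1
        then show ?thesis by (rule low')
      next
        case (2 j)
        show ?thesis
        proof (cases "j < k")
          case True
          have "(of_nat (c (2 * k * r + j)) :: bit) = of_nat (d (2 * k * r + j))"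
            using arg_cong[OF eq(1), of "\<lambda>p. coeff p j"] True by (simp only: coeff_pivot_row if_True)
          moreover have "c (2 * k * r + j) \<le> 1" "d (2 * k * r + j) \<le> 1"
            using cS(4)[OF 2(1)] dS(4)[OF 2(1)] True by auto
          ultimately show ?thesis unfolding 2
            by (auto simp: le_Suc_eq)
        qed (use cS(4)[OF 2(1)] dS(4)[OF 2(1)] 2 in auto)
      next
        case (3 j)
        show ?thesis
        proof (cases "j < k")
          case True
          have "c ((2 * k + 1) * r + j) = 1 \<longleftrightarrow> code_rows r c k j \<in> ?Tc"
            using True cS(1) by (auto dest: inj_onD)
          also have "\<dots> \<longleftrightarrow> code_rows r d k j \<in> ?Td" using eq(2) rows[OF True] by simp
          also have "\<dots> \<longleftrightarrow> d ((2 * k + 1) * r + j) = 1"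
            using True dS(1) by (auto dest: inj_onD)
          finally show ?thesis
            using cS(5)[OF 3(1)] dS(5)[OF 3(1)] True unfolding 3 by (auto simp: le_Suc_eq)
        qed (use cS(5)[OF 3(1)] dS(5)[OF 3(1)] 3 in auto)
      qed
    qed (use Suc.prems in \<open>simp add: codes_def\<close>)
  qed
qed

lemma code_rows_surj:
  assumes "B \<in> gf2_bases k" "k \<le> r"
  shows "\<exists>c\<in>codes r k. code_rows r c k ` {..<k} = B"
  using assms
proof (induction k arbitrary: B)
  case 0
  then have "finite B" "card B = 0" by (auto simp: gf2_bases_def indep_family_def)
  then have "B = {}" by simp
  then show ?case by (auto simp: codes_def)
next
  case (Suc k)
  have kr: "k < r" using Suc.prems by simp
  obtain v T S where *: "S \<in> gf2_bases k" "pivot_at k v" "T \<subseteq> S"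
    "\<forall>t\<in>T. coeff v (degree t) = 0" "B = extend_basis v T S"
    using extend_basis_exists[OF Suc.prems(1)] .
  obtain c0 where c0: "c0 \<in> codes r k" "code_rows r c0 k ` {..<k} = S"
    using Suc.IH[OF *(1)] kr by auto
  \<comment> \<open>Row \<open>2 * k\<close> spells out \<open>v\<close>, row
    \<open>2 * k + 1\<close> the indices of \<open>T\<close>. Beyond that row the last branch gives
    0 by itself, since its offset is at least \<open>r\<close> and hence not below
    \<open>k\<close>.\<close>
  define c where "c = (\<lambda>p. if p < 2 * k * r then c0 p
    else if p < (2 * k + 1) * r then of_bool (p - 2 * k * r < k \<and> coeff v (p - 2 * k * r) = 1)
    else of_bool (p - (2 * k + 1) * r < k \<and> code_rows r c0 k (p - (2 * k + 1) * r) \<in> T))"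
  have c_low: "c p = c0 p" if "p < 2 * k * r" for p using that by (simp add: c_def)
  have c_even: "c (2 * k * r + j) = of_bool (j < k \<and> coeff v j = 1)" if "j < r" for j
    using that by (simp add: c_def)
  have c_odd: "c ((2 * k + 1) * r + i) = of_bool (i < k \<and> code_rows r c0 k i \<in> T)" if "i < r" for i
    using that by (simp add: c_def)
  have pivot: "pivot_row r c k = v"
    using *(2) kr by (intro poly_eqI) (auto simp: coeff_pivot_row pivot_at_def c_even)
  have rows: "code_rows r c k i = code_rows r c0 k i" if "i < k" for i
    by (rule code_rows_cong) (use c_low kr that in auto)
  have inj: "inj_on (code_rows r c k) {..<k}"
    using code_rows_bases(2)[OF c0(1)] kr inj_on_cong[of "{..<k}", OF rows] by simp
  have img: "code_rows r c k ` {..<k} = S" using rows c0(2) by auto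
  have "T = code_rows r c k ` {i. i < k \<and> c ((2 * k + 1) * r + i) = 1}"
  proof -
    have "{i. i < k \<and> c ((2 * k + 1) * r + i) = 1} = {i. i < k \<and> code_rows r c k i \<in> T}"
      using c_odd kr rows by (auto simp: of_bool_def split: if_splits)
    then show ?thesis using *(3) img by auto
  qed
  then have "code_rows r c (Suc k) ` {..<Suc k} = B"
    unfolding code_rows_Suc_image[OF inj] pivot img *(5) by simp
  moreover have "c \<in> codes r (Suc k)"
    unfolding codes_def
  proof (intro CollectI conjI allI impI)
    fix p assume "p < 2 * Suc k * r"
    then show "c p \<le> cap r c p"
    proof (cases rule: code_index_cases)
      case 1
      also have "2 * k * r \<le> 2 * r * r" using kr by (intro mult_right_mono) auto
      finally have "p < 2 * r * r" .
      then have "cap r c p = cap r c0 p" using c_low 1 by (intro cap_cong) auto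
      then show ?thesis using c0(1) 1 c_low by (simp add: codes_def)
    next
      case (2 j)
      show ?thesis unfolding 2(2) cap_even_row[OF 2(1)] c_even[OF 2(1)] by simp
    next
      case (3 j)
      show ?thesis unfolding 3(2) cap_odd_row[OF 3(1)] c_odd[OF 3(1)] pivot
        using *(4) rows by auto
    qed
  next
    fix p assume "2 * Suc k * r \<le> p"
    then have "r \<le> p - (2 * k + 1) * r" "(2 * k + 1) * r \<le> p" by (simp_all add: algebra_simps)
    then show "c p = 0" using kr by (auto simp: c_def)
  qed
  ultimately show ?case by blast
qed

lemma bij_betw_code_rows:
  "bij_betw (\<lambda>c. code_rows r c r ` {..<r}) (codes r r) (gf2_bases r)"
  unfolding bij_betw_def
  using code_rows_inject[of _ r r] code_rows_surj[of _ r r] code_rows_bases(1)[of _ r r]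
  by (auto simp: inj_on_def image_iff) (metis order_refl)

subsection \<open>Lexicographic enumeration of the codes\<close>

lemma finite_codes: "finite (codes r r)"
proof (rule finite_subset)
  show "codes r r \<subseteq>
      {f. \<forall>p. (p \<in> {..<2 * r * r} \<longrightarrow> f p \<in> {..1}) \<and> (p \<notin> {..<2 * r * r} \<longrightarrow> f p = 0)}"
    by (auto simp: codes_def intro: le_trans[OF _ cap_le_1[unfolded One_nat_def]])
  show "finite {f. \<forall>p. (p \<in> {..<2 * r * r} \<longrightarrow> f p \<in> {..1 :: nat}) \<and>
      (p \<notin> {..<2 * r * r} \<longrightarrow> f p = 0)}"
    by (rule finite_set_of_finite_funs) auto
qed

definition lex_less :: "(nat \<Rightarrow> nat) \<Rightarrow> (nat \<Rightarrow> nat) \<Rightarrow> bool" where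
  "lex_less c d \<longleftrightarrow> (\<exists>p. c p < d p \<and> (\<forall>q<p. c q = d q))"

text \<open>The codes still to be listed when \<open>c\<close> is the current one, \<open>c\<close>
  included. Its cardinality is the induction measure for the main loop.\<close>

definition remaining :: "nat \<Rightarrow> (nat \<Rightarrow> nat) \<Rightarrow> (nat \<Rightarrow> nat) set" where
  "remaining r c = {d \<in> codes r r. \<not> lex_less d c}"

definition increment :: "(nat \<Rightarrow> nat) \<Rightarrow> nat \<Rightarrow> nat \<Rightarrow> nat" where
  "increment c p = (\<lambda>q. if q < p then c q else of_bool (q = p))"

lemma lex_less_irrefl: "\<not> lex_less c c"
  by (simp add: lex_less_def)

lemma lex_less_trans:
  assumes "lex_less c d" "lex_less d e"
  shows "lex_less c e"
proof -
  obtain p q where p: "c p < d p" "\<forall>i<p. c i = d i" and q: "d q < e q" "\<forall>i<q. d i = e i"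
    using assms by (auto simp: lex_less_def)
  have "c (min p q) < e (min p q)" "\<forall>i<min p q. c i = e i"
    using p q by (cases p q rule: linorder_cases; auto simp: min_def)+
  then show ?thesis unfolding lex_less_def by blast
qed

lemma first_difference:
  fixes c d :: "nat \<Rightarrow> nat"
  assumes "c \<noteq> d"
  obtains p where "c p \<noteq> d p" "\<forall>q<p. c q = d q"
  using assms exists_least_iff[of "\<lambda>p. c p \<noteq> d p"] by blast

text \<open>At the first difference, both codes have the same cap by \<open>cap_cong\<close>, and
  \<open>c\<close> attains it. So \<open>d\<close> can only be smaller there.\<close>

lemma lex_less_if_saturated:
  assumes d: "d \<in> codes r r" and c: "c \<in> codes r r" and "c \<noteq> d"
    and agree: "\<forall>q<p. c q = d q"
    and sat: "\<forall>q. p \<le> q \<longrightarrow> q < 2 * r * r \<longrightarrow> \<not> c q < cap r c q"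
  shows "lex_less d c"
proof -
  obtain q where q: "c q \<noteq> d q" "\<forall>i<q. c i = d i" using \<open>c \<noteq> d\<close> by (rule first_difference)
  have "p \<le> q" using agree q(1) not_less by blast
  have N: "q < 2 * r * r" using q(1) c d by (auto simp: codes_def intro: ccontr)
  have "d q \<le> cap r d q" using d N by (simp add: codes_def)
  also have "cap r d q = cap r c q" using q(2) N by (intro cap_cong) auto
  also have "\<dots> \<le> c q" using sat \<open>p \<le> q\<close> N by (simp add: not_less)
  finally show ?thesis using q unfolding lex_less_def by (metis le_neq_implies_less)
qed

text \<open>The cleared tail respects any caps. A code \<open>d\<close> below the increment either
  falls below it before \<open>p\<close>, and then also below \<open>c\<close>, or agrees with
  \<open>c\<close> up to and including \<open>p\<close>, where both have 0, and the saturated tail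
  leaves only \<open>d = c\<close> or \<open>d\<close> below \<open>c\<close>.\<close>

lemma remaining_increment:
  assumes c: "c \<in> codes r r" and p: "p < 2 * r * r" "c p < cap r c p"
    and sat: "\<forall>q. p < q \<longrightarrow> q < 2 * r * r \<longrightarrow> \<not> c q < cap r c q"
  shows "increment c p \<in> codes r r" "remaining r (increment c p) = remaining r c - {c}"
proof -
  let ?c = "increment c p"
  have cap1: "cap r c p = 1" and cp: "c p = 0" using p(2) cap_le_1[of r c p] by auto
  show "?c \<in> codes r r"
    unfolding codes_def
  proof (intro CollectI conjI allI impI)
    fix q assume q: "q < 2 * r * r"
    show "?c q \<le> cap r ?c q"
    proof (cases "q \<le> p")
      case True
      then have "cap r ?c q = cap r c q" using q by (intro cap_cong) (auto simp: increment_def)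
      then show ?thesis using True c q cap1 by (auto simp: increment_def codes_def)
    qed (simp add: increment_def)
  next
    fix q assume "2 * r * r \<le> q"
    then show "?c q = 0" using p by (simp add: increment_def)
  qed
  have less: "lex_less c ?c"
    unfolding lex_less_def using cp by (intro exI[of _ p]) (simp add: increment_def)
  have "lex_less d ?c \<longleftrightarrow> d = c \<or> lex_less d c" if d: "d \<in> codes r r" for d
  proof
    assume "lex_less d ?c"
    then obtain q where q: "d q < ?c q" "\<forall>i<q. d i = ?c i" by (auto simp: lex_less_def)
    show "d = c \<or> lex_less d c"
    proof (cases "q < p")
      case True
      then show ?thesis using q unfolding lex_less_def by (auto simp: increment_def intro!: exI[of _ q])
    next
      case False
      then have "q = p" using q(1) by (auto simp: increment_def of_bool_def split: if_splits)
      then have "\<forall>i<Suc p. c i = d i" using q cp by (auto simp: increment_def less_Suc_eq)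
      then show ?thesis
        using lex_less_if_saturated[OF d c, of "Suc p"] sat by (auto simp: Suc_le_eq)
    qed
  qed (use less lex_less_trans in blast)
  then show "remaining r ?c = remaining r c - {c}" by (auto simp: remaining_def)
qed

lemma remaining_last:
  assumes c: "c \<in> codes r r" and sat: "\<forall>q. q < 2 * r * r \<longrightarrow> \<not> c q < cap r c q"
  shows "remaining r c = {c}"
  using lex_less_if_saturated[OF _ c, of _ 0] sat c lex_less_irrefl
  by (auto simp: remaining_def)

lemma zero_code: "(\<lambda>_. 0) \<in> codes r r"
  by (simp add: codes_def)

lemma remaining_zero: "remaining r (\<lambda>_. 0) = codes r r"
  by (auto simp: remaining_def lex_less_def)

lemma mem_remaining_self: "c \<in> codes r r \<Longrightarrow> c \<in> remaining r c"
  by (simp add: remaining_def lex_less_irrefl)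

subsection \<open>Polynomials as vectors\<close>

definition low_polys :: "nat \<Rightarrow> bit poly set" where
  "low_polys r = {p. \<forall>j\<ge>r. coeff p j = 0}"

definition vec_of_low_poly :: "nat \<Rightarrow> bit poly \<Rightarrow> bit vec" where
  "vec_of_low_poly r p = vec r (coeff p)"

lemma inj_on_vec_of_low_poly: "inj_on (vec_of_low_poly r) (low_polys r)"
proof (rule inj_onI)
  fix p q assume *: "p \<in> low_polys r" "q \<in> low_polys r" "vec_of_low_poly r p = vec_of_low_poly r q"
  show "p = q"
  proof (rule poly_eqI)
    fix j
    show "coeff p j = coeff q j"
    proof (cases "j < r")
      case True
      then show ?thesis using arg_cong[OF *(3), of "\<lambda>v. v $ j"] by (simp add: vec_of_low_poly_def)
    qed (use * in \<open>simp add: low_polys_def\<close>)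
  qed
qed

lemma vec_of_low_poly_image: "vec_of_low_poly r ` low_polys r = carrier_vec r"
proof safe
  fix v :: "bit vec" assume v: "v \<in> carrier_vec r"
  let ?p = "Poly (map (\<lambda>j. v $ j) [0..<r])"
  have "coeff ?p j = (if j < r then v $ j else 0)" for j
    by (simp add: coeff_Poly_eq nth_default_def)
  then have "v = vec_of_low_poly r ?p" "?p \<in> low_polys r"
    using v by (auto simp: vec_of_low_poly_def low_polys_def)
  then show "v \<in> vec_of_low_poly r ` low_polys r" by blast
qed (simp add: vec_of_low_poly_def)

text \<open>\<open>lin_dep\<close> speaks of relations on finite subsets; extending the coefficients
  by 0 turns them into relations on all of \<open>S\<close>.\<close>

lemma lin_indpt_vec_iff:
  fixes S :: "bit vec set"
  assumes S: "S \<subseteq> carrier_vec r" "finite S"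
  shows "\<not> module.lin_dep class_ring (module_vec TYPE(bit) r) S \<longleftrightarrow>
    (\<forall>a. (\<forall>j<r. (\<Sum>x\<in>S. a x * x $ j) = 0) \<longrightarrow> (\<forall>x\<in>S. a x = 0))"
proof -
  interpret vec_space "TYPE(bit)" r .
  have lin0: "lincomb a A = 0\<^sub>v r \<longleftrightarrow> (\<forall>j<r. (\<Sum>x\<in>A. a x * x $ j) = 0)"
    if "A \<subseteq> carrier_vec r" "finite A" for a A
    using that lincomb_dim[of A a] by (auto simp: vec_eq_iff lincomb_index)
  show ?thesis
  proof
    assume nd: "\<not> lin_dep S"
    show "\<forall>a. (\<forall>j<r. (\<Sum>x\<in>S. a x * x $ j) = 0) \<longrightarrow> (\<forall>x\<in>S. a x = 0)"
    proof (intro allI impI)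
      fix a assume "\<forall>j<r. (\<Sum>x\<in>S. a x * x $ j) = 0"
      then have "lincomb a S = 0\<^sub>v r" using lin0 S by blast
      then show "\<forall>x\<in>S. a x = 0" using nd S(2) unfolding lin_dep_def by auto
    qed
  next
    assume *: "\<forall>a. (\<forall>j<r. (\<Sum>x\<in>S. a x * x $ j) = 0) \<longrightarrow> (\<forall>x\<in>S. a x = 0)"
    show "\<not> lin_dep S"
    proof
      assume "lin_dep S"
      then obtain A a v where A: "finite A" "A \<subseteq> S" "lincomb a A = 0\<^sub>v r" "v \<in> A" "a v \<noteq> 0"
        unfolding lin_dep_def by auto
      let ?a = "\<lambda>x. if x \<in> A then a x else 0"
      have "(\<Sum>x\<in>S. ?a x * x $ j) = (\<Sum>x\<in>A. a x * x $ j)" for j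
        using S A by (intro sum.mono_neutral_cong_right) auto
      moreover have "\<forall>j<r. (\<Sum>x\<in>A. a x * x $ j) = 0" using lin0[of A a] A S by blast
      ultimately have "\<forall>j<r. (\<Sum>x\<in>S. ?a x * x $ j) = 0" by presburger
      with spec[OF *, of ?a] have "\<forall>x\<in>S. ?a x = 0" by (rule mp)
      then have "?a v = 0" using A by blast
      then show False using A(4,5) by simp
    qed
  qed
qed

lemma lin_indpt_vec_of_low_poly:
  assumes B: "B \<subseteq> low_polys r" "finite B"
  shows "\<not> module.lin_dep class_ring (module_vec TYPE(bit) r) (vec_of_low_poly r ` B) \<longleftrightarrow>
    indep_family id B"
proof -
  let ?f = "vec_of_low_poly r"
  have inj: "inj_on ?f B" using inj_on_vec_of_low_poly B(1) by (rule inj_on_subset)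
  have sub: "?f ` B \<subseteq> carrier_vec r" using B(1) vec_of_low_poly_image by blast
  have sum: "(\<forall>j<r. (\<Sum>x\<in>?f ` B. a x * x $ j) = 0) \<longleftrightarrow>
      (\<Sum>p\<in>B. Polynomial.smult (a (?f p)) p) = 0" for a
  proof -
    have "(\<Sum>p\<in>B. Polynomial.smult (a (?f p)) p) = 0 \<longleftrightarrow> (\<forall>j. (\<Sum>p\<in>B. a (?f p) * coeff p j) = 0)"
      by (simp add: poly_eq_iff coeff_sum)
    also have "\<dots> \<longleftrightarrow> (\<forall>j<r. (\<Sum>p\<in>B. a (?f p) * coeff p j) = 0)"
    proof (intro iffI allI)
      fix j assume *: "\<forall>j<r. (\<Sum>p\<in>B. a (?f p) * coeff p j) = 0"
      show "(\<Sum>p\<in>B. a (?f p) * coeff p j) = 0"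
      proof (cases "j < r")
        case False
        then show ?thesis using B(1) by (intro sum.neutral) (auto simp: low_polys_def)
      qed (use * in blast)
    qed blast
    also have "\<dots> \<longleftrightarrow> (\<forall>j<r. (\<Sum>x\<in>?f ` B. a x * x $ j) = 0)"
      unfolding sum.reindex[OF inj] by (simp add: vec_of_low_poly_def)
    finally show ?thesis by blast
  qed
  have "(\<forall>a. (\<Sum>p\<in>B. Polynomial.smult (a (?f p)) p) = 0 \<longrightarrow> (\<forall>p\<in>B. a (?f p) = 0)) \<longleftrightarrow>
      (\<forall>b. (\<Sum>p\<in>B. Polynomial.smult (b p) p) = 0 \<longrightarrow> (\<forall>p\<in>B. b p = 0))"
  proof (intro iffI allI impI)
    fix b assume *: "\<forall>a. (\<Sum>p\<in>B. Polynomial.smult (a (?f p)) p) = 0 \<longrightarrow> (\<forall>p\<in>B. a (?f p) = 0)"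
      and 0: "(\<Sum>p\<in>B. Polynomial.smult (b p) p) = 0"
    \<comment> \<open>Coefficients indexed by polynomials are carried over to vectors through the
      inverse of the injection on \<open>B\<close>.\<close>
    let ?a = "\<lambda>x. b (the_inv_into B ?f x)"
    have ab: "?a (?f p) = b p" if "p \<in> B" for p using the_inv_into_f_f[OF inj that] by simp
    then have "(\<Sum>p\<in>B. Polynomial.smult (?a (?f p)) p) = (\<Sum>p\<in>B. Polynomial.smult (b p) p)"
      by (intro sum.cong) auto
    then have "\<forall>p\<in>B. ?a (?f p) = 0" using spec[OF *, of ?a] 0 by argo
    then show "\<forall>p\<in>B. b p = 0" using ab by fastforce
  next
    fix a assume *: "\<forall>b. (\<Sum>p\<in>B. Polynomial.smult (b p) p) = 0 \<longrightarrow> (\<forall>p\<in>B. b p = 0)"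
      and 0: "(\<Sum>p\<in>B. Polynomial.smult (a (?f p)) p) = 0"
    from spec[OF *, of "\<lambda>p. a (?f p)"] 0 show "\<forall>p\<in>B. a (?f p) = 0" by (rule mp)
  qed
  then show ?thesis
    unfolding lin_indpt_vec_iff[OF sub finite_imageI[OF B(2)]] sum indep_family_def
    using B(2) by (simp only: ball_simps id_apply simp_thms)
qed

lemma lin_indpt_sets_eq:
  assumes "1 \<le> r"
  shows "lin_indpt_sets r = (`) (vec_of_low_poly r) ` gf2_bases r"
proof -
  let ?f = "vec_of_low_poly r"
  have card: "card (?f ` B) = card B" if "B \<subseteq> low_polys r" for B
    using inj_on_subset[OF inj_on_vec_of_low_poly that] by (rule card_image)
  have bases: "gf2_bases r = {B. B \<subseteq> low_polys r \<and> card B = r \<and> indep_family id B}"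
    by (auto simp: gf2_bases_def low_polys_def)
  show ?thesis
  proof (intro equalityI subsetI)
    fix S assume "S \<in> lin_indpt_sets r"
    then have S: "S \<subseteq> carrier_vec r" "card S = r"
      "\<not> module.lin_dep class_ring (module_vec TYPE(bit) r) S"
      by (auto simp: lin_indpt_sets_def)
    then obtain B where B: "B \<subseteq> low_polys r" "S = ?f ` B"
      using subset_imageE[of S ?f "low_polys r"] vec_of_low_poly_image by metis
    have "card B = r" using S(2) B card by simp
    \<comment> \<open>Infinite sets have \<open>card\<close> 0, so a positive cardinality entails
      finiteness.\<close>
    moreover from this have "finite B" using assms by (intro card_ge_0_finite) simp
    ultimately have "B \<in> gf2_bases r"
      using lin_indpt_vec_of_low_poly B S(3) by (auto simp: bases)
    then show "S \<in> (`) ?f ` gf2_bases r" using B(2) by blast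
  next
    fix S assume "S \<in> (`) ?f ` gf2_bases r"
    then obtain B where B: "B \<subseteq> low_polys r" "card B = r" "indep_family id B" "S = ?f ` B"
      by (auto simp: bases)
    then have "finite B" by (simp add: indep_family_def)
    have "S \<subseteq> carrier_vec r" using B vec_of_low_poly_image[of r] by blast
    moreover have "card S = r" using B card by simp
    moreover have "\<not> module.lin_dep class_ring (module_vec TYPE(bit) r) S"
      using lin_indpt_vec_of_low_poly[OF B(1) \<open>finite B\<close>] B(3,4) by blast
    ultimately show "S \<in> lin_indpt_sets r" unfolding lin_indpt_sets_def by blast
  qed
qed

definition code_set :: "nat \<Rightarrow> (nat \<Rightarrow> nat) \<Rightarrow> bit vec set" where
  "code_set r c = (\<lambda>i. vec r (coeff (code_rows r c r i))) ` {..<r}"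

lemma bij_betw_code_set:
  assumes "1 \<le> r"
  shows "bij_betw (code_set r) (codes r r) (lin_indpt_sets r)"
proof -
  have low: "B \<subseteq> low_polys r" if "B \<in> gf2_bases r" for B
    using that by (auto simp: gf2_bases_def low_polys_def)
  have "inj_on ((`) (vec_of_low_poly r)) (gf2_bases r)"
    by (rule inj_on_subset[OF inj_on_image_Pow[OF inj_on_vec_of_low_poly[of r]]]) (use low in blast)
  then have "bij_betw ((`) (vec_of_low_poly r)) (gf2_bases r) (lin_indpt_sets r)"
    by (simp add: bij_betw_def lin_indpt_sets_eq[OF assms])
  from bij_betw_trans[OF bij_betw_code_rows this]
  show ?thesis
    by (simp add: comp_def image_image vec_of_low_poly_def code_set_def[abs_def])
qed

subsection \<open>Weakest preconditions\<close>

abbreviation seq (infixr ";;" 60) where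
  "c ;; d \<equiv> Seq c d"

fun printed :: "event list \<Rightarrow> nat list" where
  "printed [] = []"
| "printed (Printed w # tr) = w # printed tr"
| "printed (_ # tr) = printed tr"

lemma printed_append [simp]: "printed (tr @ tr') = printed tr @ printed tr'"
  by (induction tr rule: printed.induct) auto

text \<open>
  \<open>t\<close> and \<open>us\<close> are the time elapsed and the words printed before \<open>c\<close> starts; the run of \<open>c\<close> itself
  must not complete a solution.
\<close>

definition wp ::
  "nat \<Rightarrow> com \<Rightarrow> (state \<Rightarrow> nat \<Rightarrow> nat list \<Rightarrow> bool) \<Rightarrow> state \<Rightarrow> nat \<Rightarrow> nat list \<Rightarrow> bool" where
  "wp W c Q s t us \<longleftrightarrow>
    (\<exists>tr s'. exec W c s tr s' \<and> Emitted \<notin> set tr \<and> Q s' (t + length tr) (us @ printed tr))"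

lemma wp_Skip [simp]: "wp W Skip Q s t us \<longleftrightarrow> Q s (Suc t) us"
  unfolding wp_def by (fastforce elim: exec_elims intro: exec.intros)

lemma wp_Const [simp]:
  "wp W (Const x k) Q s t us \<longleftrightarrow> k < W \<and> Q (s\<lparr>reg := (reg s)(x := k)\<rparr>) (Suc t) us"
  unfolding wp_def by (fastforce elim: exec_elims intro: exec.intros)

lemma wp_Copy [simp]:
  "wp W (Copy x y) Q s t us \<longleftrightarrow> Q (s\<lparr>reg := (reg s)(x := reg s y)\<rparr>) (Suc t) us"
  unfolding wp_def by (fastforce elim: exec_elims intro: exec.intros)

lemma wp_Arith [simp]:
  "wp W (Arith f x y z) Q s t us \<longleftrightarrow> arith_val f (reg s y) (reg s z) < W \<and>
    Q (s\<lparr>reg := (reg s)(x := arith_val f (reg s y) (reg s z))\<rparr>) (Suc t) us"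
  unfolding wp_def by (fastforce elim: exec_elims intro: exec.intros)

lemma wp_Load [simp]:
  "wp W (Load x y) Q s t us \<longleftrightarrow> Q (s\<lparr>reg := (reg s)(x := mem s (reg s y))\<rparr>) (Suc t) us"
  unfolding wp_def by (fastforce elim: exec_elims intro: exec.intros)

lemma wp_Store [simp]:
  "wp W (Store x y) Q s t us \<longleftrightarrow> Q (s\<lparr>mem := (mem s)(reg s x := reg s y)\<rparr>) (Suc t) us"
  unfolding wp_def by (fastforce elim: exec_elims intro: exec.intros)

lemma wp_Print [simp]: "wp W (Print x) Q s t us \<longleftrightarrow> Q s (Suc t) (us @ [reg s x])"
  unfolding wp_def by (fastforce elim: exec_elims intro: exec.intros)

lemma wp_Seq [simp]: "wp W (c ;; d) Q s t us \<longleftrightarrow> wp W c (wp W d Q) s t us"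
proof
  assume "wp W (c ;; d) Q s t us"
  then show "wp W c (wp W d Q) s t us"
    unfolding wp_def by (fastforce elim: exec_elims simp: add.assoc)
next
  assume "wp W c (wp W d Q) s t us"
  then obtain tr s' tr' s'' where "exec W c s tr s'" "Emitted \<notin> set tr"
    "exec W d s' tr' s''" "Emitted \<notin> set tr'" "Q s'' (t + length tr + length tr') ((us @ printed tr) @ printed tr')"
    unfolding wp_def by blast
  then show "wp W (c ;; d) Q s t us"
    unfolding wp_def by (intro exI[of _ "tr @ tr'"] exI[of _ s'']) (auto intro: exec.Seq simp: add.assoc)
qed

lemma wp_If [simp]:
  "wp W (If b c d) Q s t us \<longleftrightarrow>
    (if test_val b s then wp W c Q s (Suc t) us else wp W d Q s (Suc t) us)"
proof (cases "test_val b s")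
  case True
  show ?thesis
  proof
    assume "wp W (If b c d) Q s t us"
    then show "if test_val b s then wp W c Q s (Suc t) us else wp W d Q s (Suc t) us"
      unfolding wp_def using True by (fastforce elim: exec_elims)
  next
    assume "if test_val b s then wp W c Q s (Suc t) us else wp W d Q s (Suc t) us"
    then obtain tr s' where "exec W c s tr s'" "Emitted \<notin> set tr"
      "Q s' (Suc t + length tr) (us @ printed tr)" using True by (auto simp: wp_def)
    then show "wp W (If b c d) Q s t us"
      unfolding wp_def using True
      by (intro exI[of _ "Tick # tr"] exI[of _ s']) (auto intro: exec.IfTrue)
  qed
next
  case False
  show ?thesis
  proof
    assume "wp W (If b c d) Q s t us"
    then show "if test_val b s then wp W c Q s (Suc t) us else wp W d Q s (Suc t) us"
      unfolding wp_def using False by (fastforce elim: exec_elims)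
  next
    assume "if test_val b s then wp W c Q s (Suc t) us else wp W d Q s (Suc t) us"
    then obtain tr s' where "exec W d s tr s'" "Emitted \<notin> set tr"
      "Q s' (Suc t + length tr) (us @ printed tr)" using False by (auto simp: wp_def)
    then show "wp W (If b c d) Q s t us"
      unfolding wp_def using False
      by (intro exI[of _ "Tick # tr"] exI[of _ s']) (auto intro: exec.IfFalse)
  qed
qed

lemma wp_mono:
  assumes "wp W c Q s t us" "\<And>s t us. Q s t us \<Longrightarrow> Q' s t us"
  shows "wp W c Q' s t us"
  using assms unfolding wp_def by blast

text \<open>Runs are finite by the big-step semantics, so termination must be proved along with the
  invariant; \<open>m\<close> is the decreasing variant. Time and printed words are arguments of the
  invariant, which yields running times in the same pass.\<close>

lemma wp_While:
  fixes m :: nat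
  assumes "I m s t us"
    and "\<And>m s t us. I m s t us \<Longrightarrow>
      (if test_val b s then wp W c (\<lambda>s t us. \<exists>m'<m. I m' s t us) s (Suc t) us else Q s (Suc t) us)"
  shows "wp W (While b c) Q s t us"
  using assms(1)
proof (induction m arbitrary: s t us rule: less_induct)
  case (less m)
  show ?case
  proof (cases "test_val b s")
    case True
    with assms(2)[OF less.prems] have "wp W c (\<lambda>s t us. \<exists>m'<m. I m' s t us) s (Suc t) us" by simp
    then obtain tr s' m' where *: "exec W c s tr s'" "Emitted \<notin> set tr" "m' < m"
      "I m' s' (Suc t + length tr) (us @ printed tr)"
      unfolding wp_def by blast
    from less.IH[OF *(3,4)] obtain tr' s'' where "exec W (While b c) s' tr' s''" "Emitted \<notin> set tr'"
      "Q s'' (Suc t + length tr + length tr') ((us @ printed tr) @ printed tr')"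
      unfolding wp_def by blast
    with * True show ?thesis
      unfolding wp_def
      by (intro exI[of _ "Tick # tr @ tr'"] exI[of _ s'']) (auto intro: exec.WhileTrue simp: add.assoc)
  next
    case False
    with assms(2)[OF less.prems] have "Q s (Suc t) us" by simp
    with False show ?thesis
      unfolding wp_def by (intro exI[of _ "[Tick]"] exI[of _ s]) (auto intro: exec.WhileFalse)
  qed
qed

text \<open>Counting loops, with variant \<open>n - j\<close>. The \<open>Suc t\<close> in the
  premises pays for the evaluation of the test.\<close>

lemma wp_for:
  assumes "I 0 s t us"
    and reg: "\<And>j s t us. I j s t us \<Longrightarrow> j \<le> n \<and> reg s x = j \<and> reg s y = n"
    and step: "\<And>j s t us. I j s t us \<Longrightarrow> j < n \<Longrightarrow> wp W c (I (Suc j)) s (Suc t) us"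
    and fin: "\<And>s t us. I n s t us \<Longrightarrow> Q s (Suc t) us"
  shows "wp W (While (Less x y) c) Q s t us"
proof (rule wp_While[where I = "\<lambda>m s t us. m \<le> n \<and> I (n - m) s t us" and m = n])
  show "n \<le> n \<and> I (n - n) s t us" using assms(1) by simp
next
  fix m s t us assume *: "m \<le> n \<and> I (n - m) s t us"
  then have r: "reg s x = n - m" "reg s y = n" using reg by blast+
  show "if test_val (Less x y) s
    then wp W c (\<lambda>s t us. \<exists>m'<m. m' \<le> n \<and> I (n - m') s t us) s (Suc t) us
    else Q s (Suc t) us"
  proof (cases m)
    case 0
    then show ?thesis using * r fin by simp
  next
    case (Suc m')
    then have "wp W c (I (Suc (n - m))) s (Suc t) us" using * by (intro step) auto
    then have "wp W c (\<lambda>s t us. \<exists>m'<m. m' \<le> n \<and> I (n - m') s t us) s (Suc t) us"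
      by (rule wp_mono) (use * Suc in \<open>auto simp: Suc_diff_Suc intro!: exI[of _ m']\<close>)
    then show ?thesis using * Suc r by simp
  qed
qed

subsection \<open>The program\<close>

definition cell :: "nat \<Rightarrow> nat \<Rightarrow> nat \<Rightarrow> nat" where
  "cell r i j = i * r + j"

text \<open>As a simp rule this settles all aliasing between memory rows, provided that columns stay
  below \<open>r\<close>.\<close>

lemma cell_eq_iff [simp]:
  assumes "j < r" "j' < r"
  shows "cell r i j = cell r i' j' \<longleftrightarrow> i = i' \<and> j = j'"
proof
  assume eq: "cell r i j = cell r i' j'"
  have "cell r i j div r = i" "cell r i j mod r = j" "cell r i' j' div r = i'" "cell r i' j' mod r = j'"
    using assms by (simp_all add: cell_def)
  then show "i = i' \<and> j = j'" using eq by metis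
qed simp

lemma cell_less:
  assumes "i < n" "j < r"
  shows "cell r i j < n * r"
proof -
  have "cell r i j < Suc i * r" using assms(2) by (simp add: cell_def)
  also have "\<dots> \<le> n * r" using assms(1) by (intro mult_right_mono) auto
  finally show ?thesis .
qed

definition addr :: "nat \<Rightarrow> nat \<Rightarrow> nat \<Rightarrow> com" where
  "addr x a b = Arith Multiplication x a 0 ;; Arith Addition x x b"

text \<open>\<open>x\<close> is overwritten before \<open>b\<close> is read, hence
  \<open>x \<noteq> b\<close>. The bound on \<open>W\<close> covers every address in the
  \<open>5 * r\<close> memory rows.\<close>

lemma wp_addr [simp]:
  assumes "5 * r * r \<le> W" "reg s 0 = r" "reg s a < 5 * r" "reg s b < r" "x \<noteq> b"
  shows "wp W (addr x a b) Q s t us \<longleftrightarrow>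
    Q (s\<lparr>reg := (reg s)(x := cell r (reg s a) (reg s b))\<rparr>) (Suc (Suc t)) us"
proof -
  have "cell r (reg s a) (reg s b) < W" using cell_less[OF assms(3,4)] assms(1) by simp
  then show ?thesis using assms by (simp add: addr_def cell_def)
qed

text \<open>
  Register usage: 0: \<open>r\<close>, 2: two, 3: \<open>2r\<close>, 4: \<open>4r\<close>, 5: \<open>k\<close>, 6: \<open>i\<close>, 7: \<open>j\<close>,
  15: zero, 24: one, 20: loop flag, 21--23: \<open>2r\<^sup>2\<close>, \<open>4r\<^sup>2\<close>, \<open>5r\<^sup>2\<close>; the others are scratch. The memory
  consists of rows of length \<open>r\<close>: rows \<open>0..<2r\<close> hold the code, rows \<open>2r..<4r\<close> its caps, and rows
  \<open>4r..<5r\<close> the vectors.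
\<close>

definition init_cmd :: com where
  "init_cmd = Const 24 1 ;; Const 2 2 ;; Const 15 0 ;; Const 20 1 ;;
    Arith Multiplication 3 2 0 ;; Arith Addition 4 3 3 ;;
    Arith Multiplication 21 3 0 ;; Arith Addition 22 21 21 ;;
    Arith Multiplication 14 0 0 ;; Arith Addition 23 22 14"

definition pivot_loop :: com where
  "pivot_loop = While (Less 7 0)
    (addr 13 8 7 ;; Load 14 13 ;; addr 13 12 7 ;; Store 13 14 ;;
     addr 13 11 7 ;; Store 13 15 ;;
     addr 13 10 7 ;; If (Less 7 5) (Store 13 24) (Store 13 15) ;;
     Arith Addition 7 7 24)"

text \<open>One pass does two jobs. It adds the pivot, times the mark in register 17, to vector
  \<open>i\<close>; and it overwrites register 18 with the pivot's bit wherever the old vector has a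
  1, so the last overwrite comes from its leading position.\<close>

definition add_loop :: com where
  "add_loop = While (Less 7 0)
    (addr 13 12 7 ;; Load 14 13 ;; addr 13 16 7 ;; Load 19 13 ;;
     If (Equal 19 24) (Copy 18 14) Skip ;;
     Arith Multiplication 14 14 17 ;; Arith Addition 19 19 14 ;; Arith Remainder 19 19 2 ;;
     Store 13 19 ;; Arith Addition 7 7 24)"

definition row_loop :: com where
  "row_loop = While (Less 6 5)
    (Arith Addition 16 6 4 ;; addr 13 9 6 ;; Load 17 13 ;; Const 18 0 ;; Const 7 0 ;; add_loop ;;
     Arith Subtraction 18 24 18 ;; addr 13 11 6 ;; Store 13 18 ;; Arith Addition 6 6 24)"

definition build_loop :: com where
  "build_loop = While (Less 5 0)
    (Arith Addition 8 5 5 ;; Arith Addition 9 8 24 ;; Arith Addition 10 8 3 ;;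
     Arith Addition 11 9 3 ;; Arith Addition 12 5 4 ;;
     Const 7 0 ;; pivot_loop ;; addr 13 12 5 ;; Store 13 24 ;; Const 6 0 ;; row_loop ;;
     Arith Addition 5 5 24)"

definition print_loop :: com where
  "print_loop = While (Less 13 23) (Load 14 13 ;; Print 14 ;; Arith Addition 13 13 24)"

text \<open>Saturated bits are cleared while the scan moves backwards, so nothing is left to clear
  when a bit is raised. Setting register 13 to 0 then ends the loop. The cap of a bit lies at
  distance \<open>2 * r * r\<close> from it.\<close>

definition next_loop :: com where
  "next_loop = While (Less 15 13)
    (Arith Subtraction 13 13 24 ;; Load 14 13 ;; Arith Addition 18 13 21 ;; Load 19 18 ;;
     If (Less 14 19) (Store 13 24 ;; Const 20 1 ;; Const 13 0) (Store 13 15))"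

definition output_cmd :: com where
  "output_cmd = Const 5 0 ;; build_loop ;; Copy 13 22 ;; print_loop"

definition next_cmd :: com where
  "next_cmd = Const 20 0 ;; Copy 13 21 ;; next_loop"

definition enum_cmd :: com where
  "enum_cmd = init_cmd ;; While (Equal 20 24) (output_cmd ;; Emit ;; next_cmd)"

section \<open>Correctness and running time of the loops\<close>

definition const_regs :: "nat \<Rightarrow> state \<Rightarrow> bool" where
  "const_regs r s \<longleftrightarrow> reg s 0 = r \<and> reg s 24 = 1 \<and> reg s 2 = 2 \<and> reg s 3 = 2 * r \<and> reg s 4 = 4 * r \<and>
    reg s 15 = 0 \<and> reg s 21 = 2 * r * r \<and> reg s 22 = 4 * r * r \<and> reg s 23 = 5 * r * r"

lemma pivot_loop:
  assumes W: "5 * r * r + 5 * r + 3 \<le> W" and k: "k < r" and c: "const_regs r s0"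
    and regs: "reg s0 5 = k" "reg s0 8 = 2 * k" "reg s0 10 = 2 * r + 2 * k"
      "reg s0 11 = 2 * r + (2 * k + 1)" "reg s0 12 = 4 * r + k" "reg s0 7 = 0"
    and Q: "\<And>s t'. \<lbrakk>t' \<le> t0 + 16 * r + 1; \<forall>x. x \<notin> {7, 13, 14} \<longrightarrow> reg s x = reg s0 x;
      \<forall>i j. j < r \<longrightarrow> mem s (cell r i j) =
        (if i = 2 * r + 2 * k then of_bool (j < k)
         else if i = 2 * r + (2 * k + 1) then 0
         else if i = 4 * r + k then mem s0 (cell r (2 * k) j)
         else mem s0 (cell r i j))\<rbrakk> \<Longrightarrow> Q s t' us0"
  shows "wp W pivot_loop Q s0 t0 us0"
proof -
  \<comment> \<open>An iteration costs 15 units including the test, rounded up to 16. Each column is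
    handled independently, so columns from \<open>J\<close> on are still as in
    \<open>s0\<close>.\<close>
  let ?I = "\<lambda>J (s :: state) t us. J \<le> r \<and> reg s 7 = J \<and> t \<le> t0 + 16 * J \<and> us = us0 \<and>
    (\<forall>x. x \<notin> {7, 13, 14} \<longrightarrow> reg s x = reg s0 x) \<and>
    (\<forall>i j. j < r \<longrightarrow> mem s (cell r i j) =
        (if J \<le> j then mem s0 (cell r i j)
         else if i = 2 * r + 2 * k then of_bool (j < k)
         else if i = 2 * r + (2 * k + 1) then 0
         else if i = 4 * r + k then mem s0 (cell r (2 * k) j)
         else mem s0 (cell r i j)))"
  have W': "5 * r * r \<le> W" using W by simp
  show ?thesis
    unfolding pivot_loop_def
  proof (rule wp_for[where I = ?I and n = r])
    show "?I 0 s0 t0 us0" using regs by simp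
  next
    fix J s t us assume "?I J s t us"
    then show "J \<le> r \<and> reg s 7 = J \<and> reg s 0 = r" using c by (simp add: const_regs_def)
  next
    fix J s t us assume I: "?I J s t us" and J: "J < r"
    have m: "mem s (cell r i j) =
        (if J \<le> j then mem s0 (cell r i j)
         else if i = 2 * r + 2 * k then of_bool (j < k)
         else if i = 2 * r + (2 * k + 1) then 0
         else if i = 4 * r + k then mem s0 (cell r (2 * k) j)
         else mem s0 (cell r i j))" if "j < r" for i j using I that by blast
    have rs: "reg s 7 = J" "\<And>x. x \<notin> {7, 13, 14} \<Longrightarrow> reg s x = reg s0 x"
      "t \<le> t0 + 16 * J" "us = us0" using I by blast+
    have v: "reg s 0 = r" "reg s 24 = 1" "reg s 5 = k" "reg s 8 = 2 * k" "reg s 10 = 2 * r + 2 * k"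
      "reg s 11 = 2 * r + (2 * k + 1)" "reg s 12 = 4 * r + k" "reg s 15 = 0"
      using rs(2) regs c by (simp_all add: const_regs_def)
    have "Suc J < W" using W J by simp
    then show "wp W (addr 13 8 7 ;; Load 14 13 ;; addr 13 12 7 ;; Store 13 14 ;;
       addr 13 11 7 ;; Store 13 15 ;;
       addr 13 10 7 ;; If (Less 7 5) (Store 13 24) (Store 13 15) ;;
       Arith Addition 7 7 24) (?I (Suc J)) s (Suc t) us"
      using J k rs(3) by (simp add: v rs(1,2,4) m wp_addr[OF W'] less_Suc_eq)
  next
    fix s t us assume "?I r s t us"
    then show "Q s (Suc t) us" using Q by (auto simp: not_le)
  qed
qed

text \<open>Models register 18 of \<open>add_loop\<close>: the largest position with
  \<open>x = 1\<close> wins, and 0 is returned only if there is none.\<close>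

fun lead_bit :: "(nat \<Rightarrow> nat) \<Rightarrow> (nat \<Rightarrow> nat) \<Rightarrow> nat \<Rightarrow> nat" where
  "lead_bit x y 0 = 0"
| "lead_bit x y (Suc n) = (if x n = 1 then y n else lead_bit x y n)"

lemma lead_bit_eq:
  assumes "\<And>j. j < n \<Longrightarrow> x j = of_bool (coeff p j = 1)" "p \<noteq> 0" "degree (p :: bit poly) < n"
  shows "lead_bit x y n = y (degree p)"
  using assms
proof (induction n)
  case (Suc n)
  show ?case
  proof (cases "degree p = n")
    case True
    have "coeff p (degree p) \<noteq> 0" using Suc.prems by simp
    then show ?thesis using True Suc.prems(1)[of n] by simp
  next
    case False
    then have "degree p < n" using Suc.prems by simp
    then show ?thesis using Suc.IH Suc.prems by (simp add: coeff_eq_0)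
  qed
qed simp

lemma add_loop:
  assumes W: "5 * r * r + 5 * r + 3 \<le> W" and k: "k < r" and i: "i < k" and c: "const_regs r s0"
    and regs: "reg s0 12 = 4 * r + k" "reg s0 16 = 4 * r + i" "reg s0 17 \<le> 1" "reg s0 18 = 0" "reg s0 7 = 0"
    and bits: "\<And>j. j < r \<Longrightarrow> mem s0 (cell r (4 * r + k) j) \<le> 1" "\<And>j. j < r \<Longrightarrow> mem s0 (cell r (4 * r + i) j) \<le> 1"
    and Q: "\<And>s t'. \<lbrakk>t' \<le> t0 + 16 * r + 1; \<forall>x. x \<notin> {7, 13, 14, 18, 19} \<longrightarrow> reg s x = reg s0 x;
      reg s 18 = lead_bit (\<lambda>j. mem s0 (cell r (4 * r + i) j)) (\<lambda>j. mem s0 (cell r (4 * r + k) j)) r;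
      \<forall>i' j. j < r \<longrightarrow> mem s (cell r i' j) =
        (if i' = 4 * r + i
         then (mem s0 (cell r (4 * r + i) j) + mem s0 (cell r (4 * r + k) j) * reg s0 17) mod 2
         else mem s0 (cell r i' j))\<rbrakk> \<Longrightarrow> Q s t' us0"
  shows "wp W add_loop Q s0 t0 us0"
proof -
  let ?x = "\<lambda>j. mem s0 (cell r (4 * r + i) j)" and ?y = "\<lambda>j. mem s0 (cell r (4 * r + k) j)"
  let ?I = "\<lambda>J (s :: state) t us. J \<le> r \<and> reg s 7 = J \<and> t \<le> t0 + 16 * J \<and> us = us0 \<and>
    (\<forall>x. x \<notin> {7, 13, 14, 18, 19} \<longrightarrow> reg s x = reg s0 x) \<and> reg s 18 = lead_bit ?x ?y J \<and>
    (\<forall>i' j. j < r \<longrightarrow> mem s (cell r i' j) =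
        (if i' = 4 * r + i \<and> j < J then (?x j + ?y j * reg s0 17) mod 2
         else mem s0 (cell r i' j)))"
  have W': "5 * r * r \<le> W" using W by simp
  show ?thesis
    unfolding add_loop_def
  proof (rule wp_for[where I = ?I and n = r])
    show "?I 0 s0 t0 us0" using regs by simp
  next
    fix J s t us assume "?I J s t us"
    then show "J \<le> r \<and> reg s 7 = J \<and> reg s 0 = r" using c by (simp add: const_regs_def)
  next
    fix J s t us assume I: "?I J s t us" and J: "J < r"
    have m: "mem s (cell r i' j) =
        (if i' = 4 * r + i \<and> j < J then (?x j + ?y j * reg s0 17) mod 2
         else mem s0 (cell r i' j))" if "j < r" for i' j using I that by blast
    have rs: "reg s 7 = J" "\<And>x. x \<notin> {7, 13, 14, 18, 19} \<Longrightarrow> reg s x = reg s0 x"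
      "t \<le> t0 + 16 * J" "us = us0" "reg s 18 = lead_bit ?x ?y J" using I by blast+
    have v: "reg s 0 = r" "reg s 24 = 1" "reg s 2 = 2" "reg s 12 = 4 * r + k" "reg s 16 = 4 * r + i"
      "reg s 17 = reg s0 17"
      using rs(2) regs c by (simp_all add: const_regs_def)
    have "?y J * reg s0 17 \<le> 1 * 1" using bits(1)[OF J] regs(3) by (intro mult_le_mono)
    then have "Suc J < W" "?y J * reg s0 17 < W" "?x J + ?y J * reg s0 17 < W"
      "(?x J + ?y J * reg s0 17) mod 2 < W"
      using W J bits(2)[OF J] by auto
    then show "wp W (addr 13 12 7 ;; Load 14 13 ;; addr 13 16 7 ;; Load 19 13 ;;
       If (Equal 19 24) (Copy 18 14) Skip ;;
       Arith Multiplication 14 14 17 ;; Arith Addition 19 19 14 ;; Arith Remainder 19 19 2 ;;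
       Store 13 19 ;; Arith Addition 7 7 24) (?I (Suc J)) s (Suc t) us"
      using J k i rs(3) by (simp add: v rs(1,2,4,5) m wp_addr[OF W']) (auto simp: m less_Suc_eq)
  next
    fix s t us assume "?I r s t us"
    then show "Q s (Suc t) us" using Q by auto
  qed
qed

lemma add_mod_2_eq:
  assumes "b \<le> 1"
  shows "(of_bool (coeff p j = 1) + of_bool (coeff v j = 1) * b) mod 2 =
    (of_bool (coeff (if b = 1 then p + v else p) j = (1 :: bit)) :: nat)"
  using assms by (cases "coeff p j"; cases "coeff v j"; cases b) auto

definition build_inv :: "nat \<Rightarrow> (nat \<Rightarrow> nat) \<Rightarrow> nat \<Rightarrow> (nat \<Rightarrow> nat) \<Rightarrow> bool" where
  "build_inv r c k m \<longleftrightarrow> (\<forall>q j. j < r \<longrightarrow>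
    (q < 2 * r \<longrightarrow> m (cell r q j) = c (cell r q j)) \<and>
    (q < 2 * k \<longrightarrow> m (cell r (2 * r + q) j) = cap r c (cell r q j)) \<and>
    (q < k \<longrightarrow> m (cell r (4 * r + q) j) = of_bool (coeff (code_rows r c k q) j = 1)))"

definition row_inv :: "nat \<Rightarrow> (nat \<Rightarrow> nat) \<Rightarrow> nat \<Rightarrow> nat \<Rightarrow> (nat \<Rightarrow> nat) \<Rightarrow> bool" where
  "row_inv r c k i m \<longleftrightarrow> (\<forall>q j. j < r \<longrightarrow>
    (q < 2 * r \<longrightarrow> m (cell r q j) = c (cell r q j)) \<and>
    (q \<le> 2 * k \<longrightarrow> m (cell r (2 * r + q) j) = cap r c (cell r q j)) \<and>
    m (cell r (2 * r + (2 * k + 1)) j) = (if j < i then cap r c (cell r (2 * k + 1) j) else 0) \<and>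
    m (cell r (4 * r + k) j) = of_bool (coeff (pivot_row r c k) j = 1) \<and>
    (q < i \<longrightarrow> m (cell r (4 * r + q) j) = of_bool (coeff (code_rows r c (Suc k) q) j = 1)) \<and>
    (i \<le> q \<longrightarrow> q < k \<longrightarrow> m (cell r (4 * r + q) j) = of_bool (coeff (code_rows r c k q) j = 1)))"

lemma row_invD:
  assumes "row_inv r c k i m" "j < r"
  shows "q < 2 * r \<Longrightarrow> m (cell r q j) = c (cell r q j)"
    "q \<le> 2 * k \<Longrightarrow> m (cell r (2 * r + q) j) = cap r c (cell r q j)"
    "m (cell r (2 * r + (2 * k + 1)) j) = (if j < i then cap r c (cell r (2 * k + 1) j) else 0)"
    "m (cell r (4 * r + k) j) = of_bool (coeff (pivot_row r c k) j = 1)"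
    "q < i \<Longrightarrow> m (cell r (4 * r + q) j) = of_bool (coeff (code_rows r c (Suc k) q) j = 1)"
    "i \<le> q \<Longrightarrow> q < k \<Longrightarrow> m (cell r (4 * r + q) j) = of_bool (coeff (code_rows r c k q) j = 1)"
  using assms unfolding row_inv_def by blast+

lemma cap_cell_odd:
  assumes "j < r"
  shows "cap r c (cell r (2 * k + 1) j) =
    of_bool (j < k \<and> coeff (pivot_row r c k) (degree (code_rows r c k j)) = 0)"
  unfolding cell_def by (rule cap_odd_row[OF assms])

lemma cap_cell_even: "j < r \<Longrightarrow> cap r c (cell r (2 * k) j) = of_bool (j < k)"
  unfolding cell_def by (rule cap_even_row)

lemma code_cell_le_1:
  assumes "c \<in> codes r r" "q < 2 * r" "j < r"
  shows "c (cell r q j) \<le> 1"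
  using assms cell_less[OF assms(2,3)] cap_le_1[of r c "cell r q j"]
  by (auto simp: codes_def intro: le_trans)

text \<open>By \<open>code_rows_level\<close> the old vector is nonzero of degree below
  \<open>k\<close>, so \<open>lead_bit\<close> is the pivot's coefficient at that degree; its
  complement is the cap.\<close>

lemma row_inv_Suc:
  assumes c: "c \<in> codes r r" and k: "k < r" and i: "i < k" and inv: "row_inv r c k i m"
    and m': "\<And>q j. j < r \<Longrightarrow> m' (cell r q j) =
      (if q = 4 * r + i then (m (cell r (4 * r + i) j) + m (cell r (4 * r + k) j) * c (cell r (2 * k + 1) i)) mod 2
       else if q = 2 * r + (2 * k + 1) \<and> j = i
         then 1 - lead_bit (\<lambda>j. m (cell r (4 * r + i) j)) (\<lambda>j. m (cell r (4 * r + k) j)) r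
       else m (cell r q j))"
  shows "row_inv r c k (Suc i) m'"
proof -
  note D = row_invD[OF inv]
  let ?p = "code_rows r c k i"
  have ir: "i < r" and kr: "k \<le> r" using i k by auto
  note lev = code_rows_level[OF c kr i]
  have "degree ?p < k"
  proof (rule ccontr)
    assume "\<not> degree ?p < k"
    then have "coeff ?p (degree ?p) = 0" by (intro lev(2)) simp
    then show False using lev(1) by simp
  qed
  then have deg: "degree ?p < r" using k by simp
  have "lead_bit (\<lambda>j. m (cell r (4 * r + i) j)) (\<lambda>j. m (cell r (4 * r + k) j)) r
      = m (cell r (4 * r + k) (degree ?p))"
    by (rule lead_bit_eq[OF _ lev(1) deg]) (use D(6) i in simp)
  then have lead: "1 - lead_bit (\<lambda>j. m (cell r (4 * r + i) j)) (\<lambda>j. m (cell r (4 * r + k) j)) r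
      = cap r c (cell r (2 * k + 1) i)"
    unfolding cap_cell_odd[OF ir] using D(4)[OF deg] i by simp
  have b: "c (cell r (2 * k + 1) i) \<le> 1" using c k ir by (intro code_cell_le_1) auto
  have row: "(m (cell r (4 * r + i) j) + m (cell r (4 * r + k) j) * c (cell r (2 * k + 1) i)) mod 2
      = of_bool (coeff (code_rows r c (Suc k) i) j = 1)" if "j < r" for j
    using add_mod_2_eq[OF b, of ?p j "pivot_row r c k"] D(4)[OF that] D(6)[OF that order_refl i] i
    by (simp add: cell_def)
  show ?thesis
    unfolding row_inv_def
  proof (intro allI impI conjI)
    fix q j assume j: "j < r"
    show "q < 2 * r \<Longrightarrow> m' (cell r q j) = c (cell r q j)" using m'[OF j] D(1)[OF j] by simp
    show "q \<le> 2 * k \<Longrightarrow> m' (cell r (2 * r + q) j) = cap r c (cell r q j)"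
      using m'[OF j] D(2)[OF j] k by simp
    show "m' (cell r (2 * r + (2 * k + 1)) j) =
        (if j < Suc i then cap r c (cell r (2 * k + 1) j) else 0)"
      unfolding m'[OF j] using D(3)[OF j] k lead by (auto simp: less_Suc_eq)
    show "m' (cell r (4 * r + k) j) = of_bool (coeff (pivot_row r c k) j = 1)"
      using m'[OF j] D(4)[OF j] k i by simp
    show "m' (cell r (4 * r + q) j) = of_bool (coeff (code_rows r c (Suc k) q) j = 1)"
      if "q < Suc i"
      using m'[OF j] D(5)[OF j, of q] k i that row[OF j] by (auto simp: less_Suc_eq simp del: code_rows.simps)
    show "m' (cell r (4 * r + q) j) = of_bool (coeff (code_rows r c k q) j = 1)"
      if "Suc i \<le> q" "q < k"
      using m'[OF j] D(6)[OF j, of q] k i that by simp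
  qed
qed

lemma row_loop:
  assumes W: "5 * r * r + 5 * r + 3 \<le> W" and c: "c \<in> codes r r" and k: "k < r"
    and const: "const_regs r s0"
    and regs: "reg s0 5 = k" "reg s0 9 = 2 * k + 1"
      "reg s0 11 = 2 * r + (2 * k + 1)" "reg s0 12 = 4 * r + k" "reg s0 6 = 0"
    and inv: "row_inv r c k 0 (mem s0)"
    and Q: "\<And>s t'. \<lbrakk>t' \<le> t0 + 32 * r * k + 1; \<forall>x. x \<notin> {6, 7, 13, 14, 16, 17, 18, 19} \<longrightarrow> reg s x = reg s0 x;
      row_inv r c k k (mem s)\<rbrakk> \<Longrightarrow> Q s t' us0"
  shows "wp W row_loop Q s0 t0 us0"
proof -
  \<comment> \<open>Besides \<open>add_loop\<close> with \<open>16 * r + 1\<close>, an iteration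
    costs 12 units; \<open>32 * r\<close> absorbs the sum because \<open>1 \<le> r\<close>.\<close>
  let ?I = "\<lambda>i (s :: state) t us. i \<le> k \<and> reg s 6 = i \<and> t \<le> t0 + 32 * r * i \<and> us = us0 \<and>
    (\<forall>x. x \<notin> {6, 7, 13, 14, 16, 17, 18, 19} \<longrightarrow> reg s x = reg s0 x) \<and> row_inv r c k i (mem s)"
  have W': "5 * r * r \<le> W" using W by simp
  show ?thesis
    unfolding row_loop_def
  proof (rule wp_for[where I = ?I and n = k])
    show "?I 0 s0 t0 us0" using regs inv by simp
  next
    fix i s t us assume "?I i s t us"
    then show "i \<le> k \<and> reg s 6 = i \<and> reg s 5 = k" using regs by simp
  next
    fix i s t us assume I: "?I i s t us" and i: "i < k"
    have rs: "reg s 6 = i" "\<And>x. x \<notin> {6, 7, 13, 14, 16, 17, 18, 19} \<Longrightarrow> reg s x = reg s0 x"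
      "t \<le> t0 + 32 * r * i" "us = us0" "row_inv r c k i (mem s)" using I by blast+
    have ir: "i < r" using i k by simp
    note D = row_invD[OF rs(5)]
    have v: "const_regs r s" "reg s 0 = r" "reg s 4 = 4 * r" "reg s 9 = 2 * k + 1"
      "reg s 11 = 2 * r + (2 * k + 1)" "reg s 12 = 4 * r + k"
      using rs(2) regs const by (simp_all add: const_regs_def)
    have mask: "mem s (cell r (2 * k + 1) i) = c (cell r (2 * k + 1) i)" using D(1)[OF ir] k by simp
    have b: "c (cell r (2 * k + 1) i) \<le> 1" using c k ir by (intro code_cell_le_1) auto
    define s1 where "s1 = s\<lparr>reg := (reg s)(16 := 4 * r + i, 13 := cell r (2 * k + 1) i,
      17 := c (cell r (2 * k + 1) i), 18 := 0, 7 := 0)\<rparr>"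
    have s1: "const_regs r s1" "reg s1 12 = 4 * r + k" "reg s1 16 = 4 * r + i"
      "reg s1 17 = c (cell r (2 * k + 1) i)" "reg s1 18 = 0" "reg s1 7 = 0" "mem s1 = mem s"
      using v by (simp_all add: s1_def const_regs_def)
    have "wp W add_loop (wp W (Arith Subtraction 18 24 18 ;; addr 13 11 6 ;; Store 13 18 ;;
       Arith Addition 6 6 24) (?I (Suc i))) s1
       (Suc (Suc (Suc (Suc (Suc (Suc (Suc t))))))) us"
    proof (rule add_loop[OF W k i s1(1,2,3) _ s1(5,6)])
      show "reg s1 17 \<le> 1" using b s1(4) by simp
      show "mem s1 (cell r (4 * r + k) j) \<le> 1" if "j < r" for j using D(4)[OF that] s1(7) by simp
      show "mem s1 (cell r (4 * r + i) j) \<le> 1" if "j < r" for j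
        using D(6)[OF that, of i] i s1(7) by simp
      fix s' :: state and t'
      let ?l = "lead_bit (\<lambda>j. mem s1 (cell r (4 * r + i) j)) (\<lambda>j. mem s1 (cell r (4 * r + k) j)) r"
      assume t': "t' \<le> Suc (Suc (Suc (Suc (Suc (Suc (Suc t)))))) + 16 * r + 1"
        and f: "\<forall>x. x \<notin> {7, 13, 14, 18, 19} \<longrightarrow> reg s' x = reg s1 x"
        and l: "reg s' 18 = ?l"
        and m: "\<forall>i' j. j < r \<longrightarrow> mem s' (cell r i' j) =
        (if i' = 4 * r + i
         then (mem s1 (cell r (4 * r + i) j) + mem s1 (cell r (4 * r + k) j) * reg s1 17) mod 2
         else mem s1 (cell r i' j))"
      have f': "reg s' x = reg s x" if "x \<notin> {7, 13, 14, 16, 17, 18, 19}" for x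
        using f that by (simp add: s1_def)
      have v': "reg s' 0 = r" "reg s' 24 = 1" "reg s' 6 = i" "reg s' 11 = 2 * r + (2 * k + 1)"
        using f' v rs(1) by (simp_all add: const_regs_def)
      have inv': "row_inv r c k (Suc i) ((mem s')(cell r (2 * r + (2 * k + 1)) i := 1 - ?l))"
        by (rule row_inv_Suc[OF c k i rs(5)]) (use m s1(4,7) ir k in auto)
      show "wp W (Arith Subtraction 18 24 18 ;; addr 13 11 6 ;; Store 13 18 ;;
        Arith Addition 6 6 24) (?I (Suc i)) s' t' us"
        using k i ir t' rs(3) W inv' by (simp add: wp_addr[OF W'] v' l f' rs(2,4))
    qed
    then show "wp W (Arith Addition 16 6 4 ;; addr 13 9 6 ;; Load 17 13 ;; Const 18 0 ;; Const 7 0 ;; add_loop ;;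
      Arith Subtraction 18 24 18 ;; addr 13 11 6 ;; Store 13 18 ;; Arith Addition 6 6 24)
      (?I (Suc i)) s (Suc t) us"
      using k i ir W by (simp add: wp_addr[OF W'] v rs(1) mask[simplified] s1_def add.commute[of i])
  next
    fix s t us assume "?I k s t us"
    then show "Q s (Suc t) us" using Q by auto
  qed
qed

lemma row_inv_0:
  assumes c: "c \<in> codes r r" and k: "k < r" and inv: "build_inv r c k m"
    and m': "\<And>q j. j < r \<Longrightarrow> m' (cell r q j) =
      (if q = 4 * r + k \<and> j = k then 1
       else if q = 2 * r + 2 * k then of_bool (j < k)
       else if q = 2 * r + (2 * k + 1) then 0
       else if q = 4 * r + k then m (cell r (2 * k) j)
       else m (cell r q j))"
  shows "row_inv r c k 0 m'"
proof -
  have D: "q < 2 * r \<Longrightarrow> m (cell r q j) = c (cell r q j)"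
    "q < 2 * k \<Longrightarrow> m (cell r (2 * r + q) j) = cap r c (cell r q j)"
    "q < k \<Longrightarrow> m (cell r (4 * r + q) j) = of_bool (coeff (code_rows r c k q) j = 1)"
    if "j < r" for q j
    using inv that unfolding build_inv_def by blast+
  have le: "c (cell r (2 * k) j) \<le> of_bool (j < k)" if "j < r" for j
  proof -
    have "cell r (2 * k) j < 2 * r * r" using k that by (intro cell_less) auto
    then have "c (cell r (2 * k) j) \<le> cap r c (cell r (2 * k) j)" using c by (simp add: codes_def)
    then show ?thesis unfolding cap_cell_even[OF that] .
  qed
  show ?thesis
    unfolding row_inv_def
  proof (intro allI impI conjI)
    fix q j assume j: "j < r"
    show "q < 2 * r \<Longrightarrow> m' (cell r q j) = c (cell r q j)" using m'[OF j] D(1)[OF j] by simp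
    show "m' (cell r (2 * r + q) j) = cap r c (cell r q j)" if "q \<le> 2 * k"
      using m'[OF j] D(2)[OF j, of q] cap_cell_even[OF j] k that by (cases "q = 2 * k") auto
    show "m' (cell r (2 * r + (2 * k + 1)) j) =
        (if j < 0 then cap r c (cell r (2 * k + 1) j) else 0)"
      using m'[OF j] k by simp
    show "m' (cell r (4 * r + k) j) = of_bool (coeff (pivot_row r c k) j = 1)"
    proof (cases "j = k")
      case True
      then show ?thesis using m'[OF j] by (simp add: coeff_pivot_row)
    next
      case False
      have "m' (cell r (4 * r + k) j) = c (cell r (2 * k) j)"
        using m'[OF j] D(1)[OF j] k False by simp
      also have "\<dots> = of_bool (coeff (pivot_row r c k) j = 1)"
        using le[OF j] False unfolding coeff_pivot_row cell_def
        by (cases "j < k") (auto simp: le_Suc_eq)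
      finally show ?thesis .
    qed
    show "m' (cell r (4 * r + q) j) = of_bool (coeff (code_rows r c k q) j = 1)" if "q < k"
      using m'[OF j] D(3)[OF j, of q] k that by simp
  qed simp
qed

lemma build_inv_Suc:
  assumes inv: "row_inv r c k k m" and k: "k < r"
  shows "build_inv r c (Suc k) m"
  unfolding build_inv_def
proof (intro allI impI conjI)
  note D = row_invD[OF inv]
  fix q j assume j: "j < r"
  show "q < 2 * r \<Longrightarrow> m (cell r q j) = c (cell r q j)" by (rule D(1)[OF j])
  show "m (cell r (2 * r + q) j) = cap r c (cell r q j)" if "q < 2 * Suc k"
  proof (cases "q \<le> 2 * k")
    case False
    then have q: "q = 2 * k + 1" using that by simp
    show ?thesis unfolding q D(3)[OF j] cap_cell_odd[OF j] by simp
  qed (rule D(2)[OF j])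
  show "m (cell r (4 * r + q) j) = of_bool (coeff (code_rows r c (Suc k) q) j = 1)" if "q < Suc k"
    using D(5)[OF j, of q] D(4)[OF j] that by (cases "q = k") auto
qed

lemma build_loop:
  assumes W: "5 * r * r + 5 * r + 3 \<le> W" and c: "c \<in> codes r r"
    and const: "const_regs r s0" and "reg s0 5 = 0" and inv: "build_inv r c 0 (mem s0)"
    and Q: "\<And>s t'. \<lbrakk>t' \<le> t0 + 64 * r * r * r + 1; const_regs r s; reg s 20 = reg s0 20;
      build_inv r c r (mem s)\<rbrakk> \<Longrightarrow> Q s t' us0"
  shows "wp W build_loop Q s0 t0 us0"
proof -
  let ?I = "\<lambda>k (s :: state) t us. k \<le> r \<and> reg s 5 = k \<and> t \<le> t0 + 64 * r * r * k \<and> us = us0 \<and>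
    const_regs r s \<and> reg s 20 = reg s0 20 \<and> build_inv r c k (mem s)"
  have W': "5 * r * r \<le> W" using W by simp
  show ?thesis
    unfolding build_loop_def
  proof (rule wp_for[where I = ?I and n = r])
    show "?I 0 s0 t0 us0" using assms by simp
  next
    fix k s t us assume "?I k s t us"
    then show "k \<le> r \<and> reg s 5 = k \<and> reg s 0 = r" by (simp add: const_regs_def)
  next
    fix k s t us assume I: "?I k s t us" and k: "k < r"
    then have v: "reg s 0 = r" "reg s 24 = 1" "reg s 3 = 2 * r" "reg s 4 = 4 * r" "reg s 5 = k"
      by (auto simp: const_regs_def)
    define s1 where "s1 = s\<lparr>reg := (reg s)(8 := 2 * k, 9 := 2 * k + 1, 10 := 2 * r + 2 * k,
      11 := 2 * r + (2 * k + 1), 12 := 4 * r + k, 7 := 0)\<rparr>"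
    have s1: "const_regs r s1" "reg s1 5 = k" "reg s1 8 = 2 * k" "reg s1 10 = 2 * r + 2 * k"
      "reg s1 11 = 2 * r + (2 * k + 1)" "reg s1 12 = 4 * r + k" "reg s1 7 = 0"
      using I by (simp_all add: s1_def const_regs_def)
    have "wp W pivot_loop (wp W (addr 13 12 5 ;; Store 13 24 ;; Const 6 0 ;; row_loop ;;
      Arith Addition 5 5 24) (?I (Suc k))) s1 (Suc (Suc (Suc (Suc (Suc (Suc (Suc t))))))) us"
    proof (rule pivot_loop[OF W k s1])
      fix s2 :: state and t2
      assume t2: "t2 \<le> Suc (Suc (Suc (Suc (Suc (Suc (Suc t)))))) + 16 * r + 1"
        and f2: "\<forall>x. x \<notin> {7, 13, 14} \<longrightarrow> reg s2 x = reg s1 x"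
        and m2: "\<forall>i j. j < r \<longrightarrow> mem s2 (cell r i j) =
          (if i = 2 * r + 2 * k then of_bool (j < k)
           else if i = 2 * r + (2 * k + 1) then 0
           else if i = 4 * r + k then mem s1 (cell r (2 * k) j)
           else mem s1 (cell r i j))"
      define s3 where "s3 = s2\<lparr>mem := (mem s2)(cell r (4 * r + k) k := 1),
        reg := (reg s2)(13 := cell r (4 * r + k) k, 6 := 0)\<rparr>"
      have f3: "reg s3 x = reg s1 x" if "x \<notin> {6, 7, 13, 14}" for x using f2 that by (simp add: s3_def)
      have s3: "const_regs r s3" "reg s3 5 = k" "reg s3 9 = 2 * k + 1"
        "reg s3 11 = 2 * r + (2 * k + 1)" "reg s3 12 = 4 * r + k"
        using s1 f3 by (simp_all add: const_regs_def) (simp add: s1_def)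
      have s3': "reg s3 6 = 0" by (simp add: s3_def)
      have inv3: "row_inv r c k 0 (mem s3)"
        by (rule row_inv_0[OF c k, of "mem s"]) (use I m2 k in \<open>auto simp: s3_def s1_def\<close>)
      have "wp W row_loop (wp W (Arith Addition 5 5 24) (?I (Suc k))) s3
        (Suc (Suc (Suc (Suc t2)))) us"
      proof (rule row_loop[OF W c k s3 s3' inv3])
        fix s4 :: state and t4
        assume t4: "t4 \<le> Suc (Suc (Suc (Suc t2))) + 32 * r * k + 1"
          and f4: "\<forall>x. x \<notin> {6, 7, 13, 14, 16, 17, 18, 19} \<longrightarrow> reg s4 x = reg s3 x"
          and inv4: "row_inv r c k k (mem s4)"
        have "const_regs r s4" "reg s4 5 = k" "reg s4 20 = reg s 20"
          using f4 s3 f3 by (simp_all add: const_regs_def s1_def)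
        \<comment> \<open>A level costs at most \<open>16 * r + 14 + 32 * r * k\<close>, the
          \<open>row_loop\<close> part dominating.\<close>
        moreover have "t4 + 1 \<le> t0 + 64 * r * r * Suc k"
        proof -
          have "r * k \<le> r * r" "1 \<le> r" "r \<le> r * r" using k by auto
          then have "16 * r + 16 + 32 * (r * k) \<le> 64 * (r * r)" by linarith
          then show ?thesis using t4 t2 I by (simp add: algebra_simps)
        qed
        ultimately show "wp W (Arith Addition 5 5 24) (?I (Suc k)) s4 t4 us"
          using k W I build_inv_Suc[OF inv4 k] by (auto simp: const_regs_def)
      qed
      then show "wp W (addr 13 12 5 ;; Store 13 24 ;; Const 6 0 ;; row_loop ;;
        Arith Addition 5 5 24) (?I (Suc k)) s2 t2 us"
        using k W f2 s1 by (simp add: wp_addr[OF W'] const_regs_def s3_def)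
    qed
    then show "wp W (Arith Addition 8 5 5 ;; Arith Addition 9 8 24 ;; Arith Addition 10 8 3 ;;
       Arith Addition 11 9 3 ;; Arith Addition 12 5 4 ;;
       Const 7 0 ;; pivot_loop ;; addr 13 12 5 ;; Store 13 24 ;; Const 6 0 ;; row_loop ;;
       Arith Addition 5 5 24) (?I (Suc k)) s (Suc t) us"
      using k W by (simp add: v s1_def mult_2[symmetric] add.commute)
  next
    fix s t us assume "?I r s t us"
    then show "Q s (Suc t) us" using Q by auto
  qed
qed

lemma print_loop:
  assumes W: "5 * r * r + 5 * r + 3 \<le> W" and const: "const_regs r s0" and "reg s0 13 = 4 * r * r"
    and Q: "\<And>s t'. \<lbrakk>t' \<le> t0 + 4 * r * r + 1; const_regs r s; reg s 20 = reg s0 20; mem s = mem s0\<rbrakk>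
      \<Longrightarrow> Q s t' (us0 @ map (\<lambda>q. mem s0 (4 * r * r + q)) [0..<r * r])"
  shows "wp W print_loop Q s0 t0 us0"
proof -
  let ?I = "\<lambda>m (s :: state) t us. m \<le> r * r \<and> reg s 13 = 4 * r * r + (r * r - m) \<and>
    t \<le> t0 + 4 * (r * r - m) \<and> const_regs r s \<and> reg s 20 = reg s0 20 \<and> mem s = mem s0 \<and>
    us = us0 @ map (\<lambda>q. mem s0 (4 * r * r + q)) [0..<r * r - m]"
  show ?thesis
    unfolding print_loop_def
  proof (rule wp_While[where I = ?I and m = "r * r"])
    show "?I (r * r) s0 t0 us0" using assms by simp
  next
    fix m s t us assume I: "?I m s t us"
    then have v: "reg s 23 = 4 * r * r + r * r" "reg s 24 = 1" by (simp_all add: const_regs_def)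
    show "if test_val (Less 13 23) s
      then wp W (Load 14 13 ;; Print 14 ;; Arith Addition 13 13 24)
        (\<lambda>s t us. \<exists>m'<m. ?I m' s t us) s (Suc t) us
      else Q s (Suc t) us"
    proof (cases m)
      case 0
      then show ?thesis using I v Q[of "Suc t" s] by (simp add: mult.assoc)
    next
      case (Suc m')
      then have "m' < r * r" using I by simp
      then have Sm: "r * r - m' = Suc (r * r - m)" using Suc by (simp add: Suc_diff_Suc)
      have "?I m' (s\<lparr>reg := (reg s)(14 := mem s (reg s 13), 13 := reg s 13 + 1)\<rparr>)
          (Suc (Suc (Suc (Suc t)))) (us @ [mem s (reg s 13)])"
        using I Suc unfolding Sm by (simp add: const_regs_def)
      moreover have "reg s 13 + 1 < W" using I W by (simp add: mult.assoc)
      ultimately show ?thesis using I Suc v by (auto intro!: exI[of _ m'])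
    qed
  qed
qed

subsection \<open>The enumeration\<close>

definition increment_at :: "nat \<Rightarrow> (nat \<Rightarrow> nat) \<Rightarrow> nat \<Rightarrow> bool" where
  "increment_at r c p \<longleftrightarrow> p < 2 * r * r \<and> c p < cap r c p \<and>
    (\<forall>q. p < q \<longrightarrow> q < 2 * r * r \<longrightarrow> \<not> c q < cap r c q)"

definition next_post :: "nat \<Rightarrow> (nat \<Rightarrow> nat) \<Rightarrow> state \<Rightarrow> bool" where
  "next_post r c s \<longleftrightarrow> const_regs r s \<and>
    (reg s 20 = 1 \<and> (\<exists>p. increment_at r c p \<and> (\<forall>q<2 * r * r. mem s q = increment c p q)) \<or>
     reg s 20 = 0 \<and> (\<forall>q<2 * r * r. \<not> c q < cap r c q))"

lemma next_loop:
  assumes W: "5 * r * r + 5 * r + 3 \<le> W" and const: "const_regs r s0"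
    and "reg s0 13 = 2 * r * r" "reg s0 20 = 0"
    and code: "\<And>p. p < 2 * r * r \<Longrightarrow> mem s0 p = c p"
    and caps: "\<And>p. p < 2 * r * r \<Longrightarrow> mem s0 (2 * r * r + p) = cap r c p"
    and Q: "\<And>s t'. \<lbrakk>t' \<le> t0 + 20 * r * r + 1; next_post r c s\<rbrakk> \<Longrightarrow> Q s t' us0"
  shows "wp W next_loop Q s0 t0 us0"
proof -
  \<comment> \<open>A variable in place of \<open>2 * r * r\<close> keeps the arithmetic
    linear.\<close>
  obtain N where N: "2 * r * r = N" by blast
  \<comment> \<open>The first disjunct describes the running search, the second the state after
    success, where the variant has dropped to 0. A position costs at most 9 units.\<close>
  let ?I = "\<lambda>m (s :: state) t us. reg s 13 = m \<and> m \<le> N \<and> t \<le> t0 + 10 * (N - m) \<and> us = us0 \<and>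
    const_regs r s \<and>
    (reg s 20 = 0 \<and> (\<forall>a. mem s a = (if m \<le> a \<and> a < N then 0 else mem s0 a)) \<and>
       (\<forall>q. m \<le> q \<longrightarrow> q < N \<longrightarrow> \<not> c q < cap r c q) \<or>
     m = 0 \<and> reg s 20 = 1 \<and> (\<exists>p. increment_at r c p \<and> (\<forall>q<N. mem s q = increment c p q)))"
  have W2: "2 * N + 3 \<le> W" using W N by simp
  show ?thesis
    unfolding next_loop_def
  proof (rule wp_While[where I = ?I and m = N])
    show "?I N s0 t0 us0" using assms N by auto
  next
    fix m s t us assume I: "?I m s t us"
    then have v: "reg s 15 = 0" "reg s 21 = N" "reg s 24 = 1"
      using N by (simp_all add: const_regs_def)
    show "if test_val (Less 15 13) s
      then wp W (Arith Subtraction 13 13 24 ;; Load 14 13 ;; Arith Addition 18 13 21 ;; Load 19 18 ;;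
         If (Less 14 19) (Store 13 24 ;; Const 20 1 ;; Const 13 0) (Store 13 15))
        (\<lambda>s t us. \<exists>m'<m. ?I m' s t us) s (Suc t) us
      else Q s (Suc t) us"
    proof (cases m)
      case 0
      then have "Suc t \<le> t0 + 20 * r * r + 1" "next_post r c s"
        using I N by (auto simp: next_post_def)
      then show ?thesis using 0 I v Q[of "Suc t" s] by simp
    next
      case (Suc p)
      have r13: "reg s 13 = Suc p" and flag: "reg s 20 = 0" and p: "p < N"
        and m: "\<And>a. mem s a = (if Suc p \<le> a \<and> a < N then 0 else mem s0 a)"
        and sat: "\<And>q. p < q \<Longrightarrow> q < N \<Longrightarrow> \<not> c q < cap r c q"
        and t: "t \<le> t0 + 10 * (N - Suc p)" and us: "us = us0" and cr: "const_regs r s"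
        using I Suc by auto
      have mp: "mem s p = c p" "mem s (p + N) = cap r c p"
        using m[of p] m[of "p + N"] p code caps N by (auto simp: add.commute)
      have pN: "p < W" "p + N < W" "1 < W" "0 < W" using p W2 by auto
      have tN: "t + 10 \<le> t0 + 10 * (N - p)" "10 * (N - p) \<le> 10 * N" using t p by auto
      show ?thesis
      proof (cases "c p < cap r c p")
        case True
        have inc: "increment_at r c p" using True p sat N by (auto simp: increment_at_def)
        have "((mem s)(p := 1)) q = increment c p q" if "q < N" for q
          using that m[of q] code[of q] N by (auto simp: increment_def)
        then have "?I 0 (s\<lparr>mem := (mem s)(p := 1),
            reg := (reg s)(14 := c p, 18 := p + N, 19 := cap r c p, 20 := 1, 13 := 0)\<rparr>)
            (Suc (Suc (Suc (Suc (Suc (Suc (Suc (Suc (Suc t))))))))) us"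
          using inc cr tN us by (auto simp: const_regs_def intro!: exI[of _ p])
        then show ?thesis
          using True pN v Suc by (intro if_bool_eq_conj[THEN iffD2] conjI impI)
            (auto simp: r13 mp fun_upd_twist)
      next
        case False
        have "?I p (s\<lparr>reg := (reg s)(13 := p, 14 := c p, 18 := p + N, 19 := cap r c p),
            mem := (mem s)(p := 0)\<rparr>)
            (Suc (Suc (Suc (Suc (Suc (Suc (Suc t))))))) us"
          using False cr tN us flag m sat p
          by (auto simp: const_regs_def le_less less_Suc_eq Suc_le_eq not_less)
        then show ?thesis
          using False pN v Suc by (auto simp: r13 mp fun_upd_twist intro!: exI[of _ p])
      qed
    qed
  qed
qed

lemma next_cmd:
  assumes W: "5 * r * r + 5 * r + 3 \<le> W" and const: "const_regs r s"
    and code: "\<And>p. p < 2 * r * r \<Longrightarrow> mem s p = c p"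
    and caps: "\<And>p. p < 2 * r * r \<Longrightarrow> mem s (2 * r * r + p) = cap r c p"
  shows "wp W next_cmd (\<lambda>s' t us. next_post r c s' \<and> t \<le> 20 * r * r + 3 \<and> us = []) s 0 []"
proof -
  let ?s = "s\<lparr>reg := (reg s)(20 := 0, 13 := 2 * r * r)\<rparr>"
  have "wp W next_loop (\<lambda>s' t us. next_post r c s' \<and> t \<le> 20 * r * r + 3 \<and> us = []) ?s 2 []"
    by (rule next_loop[OF W]) (use const code caps in \<open>auto simp: const_regs_def\<close>)
  then show ?thesis using const W by (simp add: next_cmd_def const_regs_def eval_nat_numeral)
qed

section \<open>One output per iteration, and the bound on the delay\<close>

definition code_words :: "nat \<Rightarrow> (nat \<Rightarrow> nat) \<Rightarrow> nat list" where
  "code_words r c =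
    map (\<lambda>q. of_bool (coeff (code_rows r c r (q div r)) (q mod r) = 1)) [0..<r * r]"

lemma build_inv_flat:
  assumes "build_inv r c r m"
  shows "p < 2 * r * r \<Longrightarrow> m p = c p" "p < 2 * r * r \<Longrightarrow> m (2 * r * r + p) = cap r c p"
    "map (\<lambda>q. m (4 * r * r + q)) [0..<r * r] = code_words r c"
proof -
  have *: "p mod r < r \<and> p div r < n \<and> cell r (p div r) (p mod r) = p \<and>
      cell r (a + p div r) (p mod r) = a * r + p"
    if "p < n * r" for p n a
  proof -
    have "0 < r" using that by (cases r) auto
    then show ?thesis using that by (simp add: cell_def less_mult_imp_div_less add_mult_distrib)
  qed
  show "m p = c p" if "p < 2 * r * r"
    using assms *[OF that, of 0] unfolding build_inv_def by metis
  show "m (2 * r * r + p) = cap r c p" if "p < 2 * r * r"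
    using assms *[OF that, of "2 * r"] unfolding build_inv_def by metis
  have "m (4 * r * r + q) = of_bool (coeff (code_rows r c r (q div r)) (q mod r) = 1)"
    if "q < r * r" for q
    using assms *[OF that, of "4 * r"] unfolding build_inv_def by metis
  then show "map (\<lambda>q. m (4 * r * r + q)) [0..<r * r] = code_words r c"
    by (simp add: code_words_def)
qed

lemma output_cmd:
  assumes W: "5 * r * r + 5 * r + 3 \<le> W" and c: "c \<in> codes r r" and const: "const_regs r s"
    and code: "\<And>p. p < 2 * r * r \<Longrightarrow> mem s p = c p"
  shows "wp W output_cmd (\<lambda>s' t us. const_regs r s' \<and> build_inv r c r (mem s') \<and>
    t \<le> 64 * r * r * r + 4 * r * r + 4 \<and> us = code_words r c) s 0 []"
proof -
  let ?Q = "\<lambda>s' t us. const_regs r s' \<and> build_inv r c r (mem s') \<and>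
    t \<le> 64 * r * r * r + 4 * r * r + 4 \<and> us = code_words r c"
  have "wp W build_loop (wp W (Copy 13 22 ;; print_loop) ?Q) (s\<lparr>reg := (reg s)(5 := 0)\<rparr>) 1 []"
  proof (rule build_loop[OF W c])
    show "const_regs r (s\<lparr>reg := (reg s)(5 := 0)\<rparr>)" using const by (simp add: const_regs_def)
    show "build_inv r c 0 (mem (s\<lparr>reg := (reg s)(5 := 0)\<rparr>))"
      using code cell_less[of _ "2 * r"] by (auto simp: build_inv_def)
    fix s1 t1
    assume t1: "t1 \<le> 1 + 64 * r * r * r + 1" and s1: "const_regs r s1"
      and inv: "build_inv r c r (mem s1)"
    have "wp W print_loop ?Q (s1\<lparr>reg := (reg s1)(13 := 4 * r * r)\<rparr>) (Suc t1) []"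
      by (rule print_loop[OF W])
        (use t1 s1 inv build_inv_flat(3)[OF inv] in \<open>auto simp: const_regs_def\<close>)
    then show "wp W (Copy 13 22 ;; print_loop) ?Q s1 t1 []" using s1 by (simp add: const_regs_def)
  qed simp
  then show ?thesis using W by (simp add: output_cmd_def)
qed

text \<open>\<open>wp\<close> excludes \<open>Emitted\<close>, so the runs before and after
  \<open>Emit\<close> are obtained separately and joined in \<open>exec\<close>. The constant 100
  generously covers 72 and 23.\<close>

lemma iteration:
  assumes W: "5 * r * r + 5 * r + 3 \<le> W" and r: "1 \<le> r" and c: "c \<in> codes r r"
    and const: "const_regs r s" and code: "\<And>p. p < 2 * r * r \<Longrightarrow> mem s p = c p"
  obtains tr1 tr2 s' where
    "exec W (output_cmd ;; Emit ;; next_cmd) s (tr1 @ Emitted # tr2) s'"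
    "Emitted \<notin> set tr1" "Emitted \<notin> set tr2" "printed tr1 = code_words r c" "printed tr2 = []"
    "length tr1 \<le> 100 * r ^ 3" "length tr2 \<le> 100 * r ^ 3" "next_post r c s'"
proof -
  obtain tr1 s1 where 1: "exec W output_cmd s tr1 s1" "Emitted \<notin> set tr1" "const_regs r s1"
    "build_inv r c r (mem s1)" "length tr1 \<le> 64 * r * r * r + 4 * r * r + 4"
    "printed tr1 = code_words r c"
    using output_cmd[OF W c const code] unfolding wp_def by auto
  obtain tr2 s2 where 2: "exec W next_cmd s1 tr2 s2" "Emitted \<notin> set tr2" "next_post r c s2"
    "length tr2 \<le> 20 * r * r + 3" "printed tr2 = []"
    using next_cmd[OF W 1(3) build_inv_flat(1,2)[OF 1(4)]] unfolding wp_def by auto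
  have "r * r \<le> r ^ 3" "1 \<le> r ^ 3" "r * r * r = r ^ 3"
    using r by (auto simp: power3_eq_cube)
  then have "length tr1 \<le> 100 * r ^ 3" "length tr2 \<le> 100 * r ^ 3"
    using 1(5) 2(4) by (simp_all add: mult.assoc)
  moreover have "exec W (output_cmd ;; Emit ;; next_cmd) s (tr1 @ [Emitted] @ tr2) s2"
    by (intro exec.Seq[OF 1(1)] exec.Seq[OF exec.Emit] 2(1))
  ultimately show thesis using 1 2 by (intro that[of tr1 tr2 s2]) auto
qed

lemma solutions_append:
  "Emitted \<notin> set tr \<Longrightarrow> solutions ws (tr @ tr') = solutions (ws @ printed tr) tr'"
  by (induction ws tr rule: solutions.induct) auto

lemma gaps_append: "Emitted \<notin> set tr \<Longrightarrow> gaps t (tr @ tr') = gaps (t + length tr) tr'"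
  by (induction t tr rule: gaps.induct) auto

text \<open>The quantified \<open>t\<close> is the time already elapsed since the last output when
  the loop is entered, namely the search of the preceding iteration. A gap is then at most
  \<open>100 * r ^ 3\<close> for that search, as much for the output, and 2 for the loop test and
  \<open>Emit\<close>, which gives 202.\<close>

lemma main_loop:
  assumes W: "5 * r * r + 5 * r + 3 \<le> W" and r: "1 \<le> r" and c: "c \<in> codes r r"
    and const: "const_regs r s" and flag: "reg s 20 = 1"
    and code: "\<And>p. p < 2 * r * r \<Longrightarrow> mem s p = c p"
  shows "\<exists>tr s' cs. exec W (While (Equal 20 24) (output_cmd ;; Emit ;; next_cmd)) s tr s' \<and>
    solutions [] tr = map (code_words r) cs \<and> distinct cs \<and> set cs = remaining r c \<and>
    (\<forall>t \<le> 100 * r ^ 3. \<forall>g \<in> set (gaps t tr). g \<le> 202 * r ^ 3)"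
  using c const flag code
proof (induction "card (remaining r c)" arbitrary: c s rule: less_induct)
  case less
  let ?loop = "While (Equal 20 24) (output_cmd ;; Emit ;; next_cmd)"
  have fin: "finite (remaining r c)" using finite_codes by (simp add: remaining_def)
  obtain tr1 tr2 s1 where
    ex: "exec W (output_cmd ;; Emit ;; next_cmd) s (tr1 @ Emitted # tr2) s1"
    and E: "Emitted \<notin> set tr1" "Emitted \<notin> set tr2"
    and P: "printed tr1 = code_words r c" "printed tr2 = []"
    and L: "length tr1 \<le> 100 * r ^ 3" "length tr2 \<le> 100 * r ^ 3" and post: "next_post r c s1"
    using iteration[OF W r less.prems(1,2,4)] .
  have r3: "1 \<le> r ^ 3" using r by simp
  have test: "test_val (Equal 20 24) s" using less.prems by (simp add: const_regs_def)
  have step: "\<exists>tr s' cs. exec W ?loop s tr s' \<and>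
      solutions [] tr = map (code_words r) cs \<and> distinct cs \<and> set cs = remaining r c \<and>
      (\<forall>t \<le> 100 * r ^ 3. \<forall>g \<in> set (gaps t tr). g \<le> 202 * r ^ 3)"
    if rest: "exec W ?loop s1 tr s'" "solutions [] tr = map (code_words r) cs" "distinct cs"
      "set cs = remaining r c - {c}"
      "\<forall>t \<le> 100 * r ^ 3. \<forall>g \<in> set (gaps t tr). g \<le> 202 * r ^ 3" for tr s' cs
  proof (intro exI conjI)
    show "exec W ?loop s (Tick # (tr1 @ Emitted # tr2) @ tr) s'"
      by (rule exec.WhileTrue[OF test ex rest(1)])
    show "solutions [] (Tick # (tr1 @ Emitted # tr2) @ tr) = map (code_words r) (c # cs)"
      using E P rest(2) by (simp add: solutions_append)
    show "distinct (c # cs)" "set (c # cs) = remaining r c"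
      using rest(3,4) mem_remaining_self[OF less.prems(1)] by auto
    show "\<forall>t \<le> 100 * r ^ 3. \<forall>g \<in> set (gaps t (Tick # (tr1 @ Emitted # tr2) @ tr)). g \<le> 202 * r ^ 3"
      using E L r3 rest(5) by (auto simp: gaps_append)
  qed
  from post consider
      p where "reg s1 20 = 1" "increment_at r c p" "\<forall>q<2 * r * r. mem s1 q = increment c p q"
    | "reg s1 20 = 0" "\<forall>q<2 * r * r. \<not> c q < cap r c q"
    unfolding next_post_def by (elim conjE disjE exE) auto
  then show ?case
  proof cases
    case (1 p)
    then have inc: "increment c p \<in> codes r r" "remaining r (increment c p) = remaining r c - {c}"
      using remaining_increment[OF less.prems(1)] by (auto simp: increment_at_def)
    have "card (remaining r (increment c p)) < card (remaining r c)"
      unfolding inc(2) using fin mem_remaining_self[OF less.prems(1)] by (rule card_Diff1_less)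
    moreover have "const_regs r s1" using post by (simp add: next_post_def)
    ultimately obtain tr s' cs where "exec W ?loop s1 tr s'"
      "solutions [] tr = map (code_words r) cs" "distinct cs" "set cs = remaining r c - {c}"
      "\<forall>t \<le> 100 * r ^ 3. \<forall>g \<in> set (gaps t tr). g \<le> 202 * r ^ 3"
      using less.hyps[OF _ inc(1) _ 1(1)] 1(3) unfolding inc(2) by auto
    then show ?thesis by (rule step)
  next
    case 2
    have "exec W ?loop s1 [Tick] s1"
      by (rule exec.WhileFalse) (use 2 post in \<open>simp add: next_post_def const_regs_def\<close>)
    moreover have "remaining r c - {c} = {}" using remaining_last[OF less.prems(1)] 2(2) by simp
    ultimately show ?thesis using r3 by (intro step[of "[Tick]" s1 "[]"]) auto
  qed
qed

lemma code_words_props: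
  shows "is_code r (code_words r c)" "decode r (code_words r c) = code_set r c"
proof -
  show "is_code r (code_words r c)" by (auto simp: is_code_def code_words_def)
  have "of_nat (code_words r c ! (i * r + j)) = coeff (code_rows r c r i) j" if "i < r" "j < r" for i j
    using cell_less[OF that] that by (simp add: code_words_def cell_def)
  then show "decode r (code_words r c) = code_set r c"
    unfolding decode_def code_set_def by (intro image_cong refl) (auto intro!: eq_vecI)
qed

lemma enum_cmd:
  assumes r: "1 \<le> r"
  shows "\<exists>d. enumerates_with_delay enum_cmd 14 r d \<and> d \<le> 202 * r ^ 3"
proof -
  let ?W = "word_bound 14 r"
  \<comment> \<open>The constant of \<open>word_bound\<close> is factor and exponent at once. At
    \<open>r = 1\<close> the words must reach 13, which the factor 14 allows.\<close>
  have "r * r \<le> r ^ 14" using r power_increasing[of 2 14 r] by (simp add: power2_eq_square)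
  moreover have "r \<le> r * r" by simp
  ultimately have "5 * (r * r) + 5 * r + 3 \<le> 14 * r ^ 14" "2 < 14 * r ^ 14" using r by linarith+
  then have W: "5 * r * r + 5 * r + 3 \<le> ?W" and W1: "2 < ?W"
    by (simp_all only: word_bound_def mult.assoc)
  let ?s = "init_state r (\<lambda>_. 0)"
  have "wp ?W init_cmd (\<lambda>s t us. const_regs r s \<and> reg s 20 = 1 \<and> mem s = (\<lambda>_. 0) \<and> t = 10 \<and> us = []) ?s 0 []"
    using W W1 r by (simp add: init_cmd_def init_state_def const_regs_def mult_2[symmetric])
  then obtain tr0 s0 where 0: "exec ?W init_cmd ?s tr0 s0" "Emitted \<notin> set tr0" "const_regs r s0"
    "reg s0 20 = 1" "mem s0 = (\<lambda>_. 0)" "length tr0 = 10" "printed tr0 = []"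
    unfolding wp_def by auto
  obtain tr s cs where m: "exec ?W (While (Equal 20 24) (output_cmd ;; Emit ;; next_cmd)) s0 tr s"
    "solutions [] tr = map (code_words r) cs" "distinct cs" "set cs = codes r r"
    "\<forall>t \<le> 100 * r ^ 3. \<forall>g \<in> set (gaps t tr). g \<le> 202 * r ^ 3"
    using main_loop[OF W r zero_code 0(3,4)] 0(5) remaining_zero by auto
  have ex: "exec ?W enum_cmd ?s (tr0 @ tr) s"
    unfolding enum_cmd_def by (rule exec.Seq[OF 0(1) m(1)])
  have sol: "solutions [] (tr0 @ tr) = map (code_words r) cs"
    using m(2) 0(2,7) by (simp add: solutions_append)
  have dec: "map (decode r) (solutions [] (tr0 @ tr)) = map (code_set r) cs"
    unfolding sol by (simp add: code_words_props)
  note bij = bij_betw_code_set[OF r]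
  have "enumerates_with_delay enum_cmd 14 r (delay (tr0 @ tr))"
    unfolding enumerates_with_delay_def dec
  proof (intro exI conjI)
    show "exec ?W enum_cmd ?s (tr0 @ tr) s" by (rule ex)
  next
    show "\<forall>ws\<in>set (solutions [] (tr0 @ tr)). is_code r ws"
      unfolding sol by (auto simp: code_words_props)
  next
    show "distinct (map (decode r) (solutions [] (tr0 @ tr)))"
      unfolding dec using m(3,4) bij by (simp add: distinct_map bij_betw_def)
  next
    show "set (map (decode r) (solutions [] (tr0 @ tr))) = lin_indpt_sets r"
      unfolding dec using m(4) bij by (simp add: bij_betw_def)
  qed simp
  moreover have "delay (tr0 @ tr) \<le> 202 * r ^ 3"
  proof -
    have "gaps 0 (tr0 @ tr) = gaps 10 tr" using 0(2,6) by (simp add: gaps_append)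
    moreover have "gaps t tr \<noteq> []" for t by (induction t tr rule: gaps.induct) auto
    \<comment> \<open>The 10 steps of initialisation play the part of the elapsed time
      \<open>t\<close> before the first output.\<close>
    moreover have "10 \<le> 100 * r ^ 3" using r one_le_power[of r 3] by linarith
    with m(5) have "\<forall>g \<in> set (gaps 10 tr). g \<le> 202 * r ^ 3" by blast
    ultimately show ?thesis unfolding delay_def by (subst Max_le_iff) auto
  qed
  ultimately show ?thesis by blast
qed

theorem theorem4:
  fixes D :: com and \<tau> :: "nat \<Rightarrow> nat"
  assumes "computes_det_in_time D \<tau>"
  shows "\<exists>(E :: com) (K :: nat) (d :: nat \<Rightarrow> nat).
           (\<forall>r\<ge>1. enumerates_with_delay E K r (d r)) \<and>
           (\<lambda>r. real (d r)) \<in> O(\<lambda>r. real r ^ 3 + real r ^ 2 * real (\<tau> r))"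
proof -
  obtain d where d: "\<And>r. 1 \<le> r \<Longrightarrow> enumerates_with_delay enum_cmd 14 r (d r) \<and> d r \<le> 202 * r ^ 3"
    using enum_cmd by metis
  have "(\<lambda>r. real (d r)) \<in> O(\<lambda>r. real r ^ 3 + real r ^ 2 * real (\<tau> r))"
  proof (rule bigoI[of _ 202])
    show "\<forall>\<^sub>F r in at_top. norm (real (d r)) \<le> 202 * norm (real r ^ 3 + real r ^ 2 * real (\<tau> r))"
      using eventually_ge_at_top[of 1]
    proof eventually_elim
      case (elim r)
      have "real (d r) \<le> real (202 * r ^ 3)" using d[OF elim] by (simp only: of_nat_le_iff)
      \<comment> \<open>The second summand is nonnegative, so the cubic bound passes to the
        sum.\<close>
      also have "\<dots> \<le> 202 * (real r ^ 3 + real r ^ 2 * real (\<tau> r))" by simp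
      finally show ?case by simp
    qed
  qed
  with d show ?thesis by blast
qed

end
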